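(* There exist uncountably many isomorphism types of countable simple subgroups of $\mathrm{Homeo}^+(I)$ which admit no nontrivial $C^1$ action on $I$.
   Context: $I=[0,1]$ and $\mathrm{Homeo}^+(I)$ is the group of orientation preserving homeomorphisms of $I$. A group $S$ admits no nontrivial $C^1$ action on $I$ if every homomorphism from $S$ to the group of $C^1$ orientation preserving diffeomorphisms of $I$ is trivial. *)

theory Defs
  imports "HOL-Analysis.Analysis" "HOL-Algebra.Algebra"
begin

section \<open>Homeomorphisms and diffeomorphisms of the unit interval\<close>

abbreviation I01 :: "real set" where "I01 \<equiv> {0..1}"

text \<open>Maps of the interval are total functions on the reals. As in the library's \<^const>\<open>Bij\<close>, they are
  taken \<^const>\<open>extensional\<close>, so that equality of functions is equality on the interval.\<close>

definition homeo_plus_I :: "(real \<Rightarrow> real) set" where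
  "homeo_plus_I = {f \<in> extensional I01. (\<exists>g. homeomorphism I01 I01 f g) \<and> strict_mono_on I01 f}"

text \<open>The derivative is taken within the interval, hence is one-sided at the end points. (The library's
  \<open>C1_differentiable_on\<close> uses two-sided derivatives and would see the values outside the interval.)\<close>

definition C1_on_I :: "(real \<Rightarrow> real) \<Rightarrow> bool" where
  "C1_on_I f \<longleftrightarrow> (\<exists>f'. (\<forall>x\<in>I01. (f has_real_derivative f' x) (at x within I01)) \<and> continuous_on I01 f')"

definition diff1_plus_I :: "(real \<Rightarrow> real) set" where
  "diff1_plus_I = {f \<in> homeo_plus_I. C1_on_I f \<and> C1_on_I (inv_into I01 f)}"

definition Homeo_plus_I :: "(real \<Rightarrow> real) monoid" where
  "Homeo_plus_I = (BijGroup I01)\<lparr>carrier := homeo_plus_I\<rparr>"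

definition Diff1_plus_I :: "(real \<Rightarrow> real) monoid" where
  "Diff1_plus_I = (BijGroup I01)\<lparr>carrier := diff1_plus_I\<rparr>"

section \<open>Group-theoretic notions\<close>

text \<open>The library's \<^locale>\<open>simple_group\<close> demands \<open>order G > 1\<close>, where \<^const>\<open>order\<close> is the cardinality
  with value 0 on infinite carriers. It therefore covers finite groups only, so simplicity
  is defined here for groups of arbitrary cardinality.\<close>

definition is_simple :: "('a, 'b) monoid_scheme \<Rightarrow> bool" where
  "is_simple G \<longleftrightarrow> group G \<and> carrier G \<noteq> {\<one>\<^bsub>G\<^esub>} \<and> (\<forall>H. H \<lhd> G \<longrightarrow> H = carrier G \<or> H = {\<one>\<^bsub>G\<^esub>})"

definition no_nontrivial_C1_action :: "('a, 'b) monoid_scheme \<Rightarrow> bool" where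
  "no_nontrivial_C1_action G \<longleftrightarrow>
     (\<forall>\<phi> \<in> hom G Diff1_plus_I. \<forall>x \<in> carrier G. \<phi> x = \<one>\<^bsub>Diff1_plus_I\<^esub>)"

definition iso_rel :: "('a, 'b) monoid_scheme \<Rightarrow> ('a set \<times> 'a set) set" where
  "iso_rel G = {(S, T). subgroup S G \<and> subgroup T G \<and> G\<lparr>carrier := S\<rparr> \<cong> G\<lparr>carrier := T\<rparr>}"

section \<open>The definitions yield groups and an equivalence relation\<close>

lemma homeo_plus_I_subset_Bij: "homeo_plus_I \<subseteq> Bij I01"
proof
  fix f assume f: "f \<in> homeo_plus_I"
  then obtain g where g: "homeomorphism I01 I01 f g" and "f \<in> extensional I01"
    by (auto simp: homeo_plus_I_def)
  moreover have "bij_betw f I01 I01"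
    using g by (intro bij_betw_byWitness[where f' = g]) (auto simp: homeomorphism_def)
  ultimately show "f \<in> Bij I01" by (simp add: Bij_def)
qed

lemma homeo_plus_I_id: "(\<lambda>x\<in>I01. x) \<in> homeo_plus_I"
proof -
  have "homeomorphism I01 I01 (\<lambda>x\<in>I01. x) (\<lambda>x. x)"
    by (rule homeomorphism_cong[OF homeomorphism_ident]) auto
  then show ?thesis by (auto simp: homeo_plus_I_def strict_mono_on_def)
qed

lemma homeo_plus_I_compose:
  assumes "f \<in> homeo_plus_I" "g \<in> homeo_plus_I"
  shows "compose I01 f g \<in> homeo_plus_I"
proof -
  from assms obtain f' g' where h: "homeomorphism I01 I01 f f'" "homeomorphism I01 I01 g g'"
    and m: "strict_mono_on I01 f" "strict_mono_on I01 g"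
    by (auto simp: homeo_plus_I_def)
  have im: "g x \<in> I01" if "x \<in> I01" for x
    using homeomorphism_image1[OF h(2)] imageI[OF that, of g] by (simp only:)
  have "homeomorphism I01 I01 (f \<circ> g) (g' \<circ> f')"
    using homeomorphism_compose[OF h(2) h(1)] .
  then have "homeomorphism I01 I01 (compose I01 f g) (g' \<circ> f')"
    by (rule homeomorphism_cong) (auto simp: compose_def)
  moreover have "strict_mono_on I01 (compose I01 f g)"
  proof (rule strict_mono_onI)
    fix r s :: real assume rs: "r \<in> I01" "s \<in> I01" "r < s"
    have "f (g r) < f (g s)"
      using rs by (intro strict_mono_onD[OF m(1)] strict_mono_onD[OF m(2)] im)
    then show "compose I01 f g r < compose I01 f g s"
      using rs by (simp add: compose_def)
  qed
  ultimately show ?thesis unfolding homeo_plus_I_def by (blast intro: compose_extensional)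
qed

lemma homeo_plus_I_inv:
  assumes "f \<in> homeo_plus_I"
  shows "(\<lambda>x\<in>I01. inv_into I01 f x) \<in> homeo_plus_I"
proof -
  from assms obtain g where h: "homeomorphism I01 I01 f g" and m: "strict_mono_on I01 f"
    by (auto simp: homeo_plus_I_def)
  have inj: "inj_on f I01" and im: "f ` I01 = I01"
    using assms homeo_plus_I_subset_Bij by (auto simp: Bij_def bij_betw_def)
  have eq: "inv_into I01 f x = g x" if "x \<in> I01" for x
    using h that inj im by (intro inv_into_f_eq) (auto simp: homeomorphism_def)
  have "homeomorphism I01 I01 g f" using h by (rule homeomorphism_symD)
  then have "homeomorphism I01 I01 (\<lambda>x\<in>I01. inv_into I01 f x) f"
    by (rule homeomorphism_cong) (auto simp: eq)
  moreover have "strict_mono_on I01 (\<lambda>x\<in>I01. inv_into I01 f x)"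
  proof (rule strict_mono_onI)
    fix r s :: real assume rs: "r \<in> I01" "s \<in> I01" "r < s"
    have g: "g r \<in> I01" "g s \<in> I01" "f (g r) = r" "f (g s) = s"
      using h rs by (auto simp: homeomorphism_def)
    have "g r < g s"
      using strict_mono_on_less[OF m g(1,2)] g rs by simp
    then show "(\<lambda>x\<in>I01. inv_into I01 f x) r < (\<lambda>x\<in>I01. inv_into I01 f x) s"
      using rs eq by simp
  qed
  ultimately show ?thesis by (auto simp: homeo_plus_I_def)
qed

lemma subgroup_homeo_plus_I: "subgroup homeo_plus_I (BijGroup I01)"
proof (unfold_locales)
  show "homeo_plus_I \<subseteq> carrier (BijGroup I01)"
    using homeo_plus_I_subset_Bij by (simp add: BijGroup_def)
  show "x \<otimes>\<^bsub>BijGroup I01\<^esub> y \<in> homeo_plus_I" if "x \<in> homeo_plus_I" "y \<in> homeo_plus_I" for x y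
    using that homeo_plus_I_subset_Bij homeo_plus_I_compose by (auto simp: BijGroup_def)
  show "\<one>\<^bsub>BijGroup I01\<^esub> \<in> homeo_plus_I"
    using homeo_plus_I_id by (simp add: BijGroup_def)
  show "inv\<^bsub>BijGroup I01\<^esub> x \<in> homeo_plus_I" if "x \<in> homeo_plus_I" for x
    using that homeo_plus_I_subset_Bij homeo_plus_I_inv inv_BijGroup[of x I01] by auto
qed

lemma group_Homeo_plus_I: "group Homeo_plus_I"
  unfolding Homeo_plus_I_def
  by (rule subgroup.subgroup_is_group[OF subgroup_homeo_plus_I group_BijGroup])

lemma DERIV_cong_within_I01:
  assumes "\<And>x. x \<in> I01 \<Longrightarrow> f x = g x" "x \<in> I01"
  shows "(f has_real_derivative D) (at x within I01) \<longleftrightarrow> (g has_real_derivative D) (at x within I01)"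
proof
  show "(g has_real_derivative D) (at x within I01)" if "(f has_real_derivative D) (at x within I01)"
    by (rule has_field_derivative_transform_within[OF that zero_less_one assms(2)]) (rule assms(1))
  show "(f has_real_derivative D) (at x within I01)" if "(g has_real_derivative D) (at x within I01)"
    by (rule has_field_derivative_transform_within[OF that zero_less_one assms(2)]) (rule assms(1)[symmetric])
qed

lemma C1_on_I_cong: "(\<And>x. x \<in> I01 \<Longrightarrow> f x = g x) \<Longrightarrow> C1_on_I f \<longleftrightarrow> C1_on_I g"
proof -
  assume "\<And>x. x \<in> I01 \<Longrightarrow> f x = g x"
  note D = DERIV_cong_within_I01[of f g, OF this]
  have "(\<forall>x\<in>I01. (f has_real_derivative f' x) (at x within I01)) \<longleftrightarrow>
        (\<forall>x\<in>I01. (g has_real_derivative f' x) (at x within I01))" for f'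
    by (rule ball_cong[OF refl], rule D)
  then show ?thesis unfolding C1_on_I_def by (simp only:)
qed

lemma C1_on_I_id: "C1_on_I (\<lambda>x. x)"
  unfolding C1_on_I_def by (rule exI[of _ "\<lambda>_. 1"]) simp

lemma C1_on_I_compose:
  assumes "C1_on_I f" "C1_on_I g" "g ` I01 \<subseteq> I01"
  shows "C1_on_I (f \<circ> g)"
proof -
  from assms obtain f' g' where
    f: "\<And>x. x \<in> I01 \<Longrightarrow> (f has_real_derivative f' x) (at x within I01)" "continuous_on I01 f'" and
    g: "\<And>x. x \<in> I01 \<Longrightarrow> (g has_real_derivative g' x) (at x within I01)" "continuous_on I01 g'"
    unfolding C1_on_I_def by blast
  have cg: "continuous_on I01 g"
    using g(1) by (rule DERIV_continuous_on)
  have "(f \<circ> g has_real_derivative f' (g x) * g' x) (at x within I01)" if "x \<in> I01" for x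
  proof (rule DERIV_image_chain[OF _ g(1)[OF that]])
    show "(f has_real_derivative f' (g x)) (at (g x) within g ` I01)"
    proof (rule DERIV_subset[OF f(1) assms(3)])
      show "g x \<in> I01" using that assms(3) by blast
    qed
  qed
  moreover have "continuous_on I01 (\<lambda>x. f' (g x) * g' x)"
    by (rule continuous_on_mult[OF continuous_on_compose2[OF f(2) cg assms(3)] g(2)])
  ultimately show ?thesis
    unfolding C1_on_I_def by (intro exI[of _ "\<lambda>x. f' (g x) * g' x"] conjI ballI)
qed

lemma subgroup_diff1_plus_I: "subgroup diff1_plus_I (BijGroup I01)"
proof (unfold_locales)
  have sub: "diff1_plus_I \<subseteq> homeo_plus_I" by (auto simp: diff1_plus_I_def)
  show "diff1_plus_I \<subseteq> carrier (BijGroup I01)"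
    using homeo_plus_I_subset_Bij sub by (auto simp: BijGroup_def)
  have B: "inj_on f I01" "f ` I01 = I01" if "f \<in> homeo_plus_I" for f
    using that homeo_plus_I_subset_Bij by (auto simp: Bij_def bij_betw_def)
  show "x \<otimes>\<^bsub>BijGroup I01\<^esub> y \<in> diff1_plus_I" if xy: "x \<in> diff1_plus_I" "y \<in> diff1_plus_I" for x y
  proof -
    have h: "x \<in> homeo_plus_I" "y \<in> homeo_plus_I" using xy sub by auto
    have c: "compose I01 x y \<in> homeo_plus_I" using h by (rule homeo_plus_I_compose)
    have "C1_on_I (x \<circ> y)"
      using xy B[OF h(2)] by (intro C1_on_I_compose) (auto simp: diff1_plus_I_def)
    then have 1: "C1_on_I (compose I01 x y)"
      by (subst C1_on_I_cong[of _ "x \<circ> y"]) (auto simp: compose_def)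
    have "C1_on_I (inv_into I01 y \<circ> inv_into I01 x)"
    proof (rule C1_on_I_compose)
      show "inv_into I01 x ` I01 \<subseteq> I01" using inv_into_into[of _ x I01] unfolding B(2)[OF h(1)] by blast
    qed (use xy in \<open>auto simp: diff1_plus_I_def\<close>)
    moreover have "inv_into I01 (compose I01 x y) z = (inv_into I01 y \<circ> inv_into I01 x) z"
      if z: "z \<in> I01" for z
    proof (rule inv_into_f_eq)
      show "inj_on (compose I01 x y) I01" using B[OF c] by simp
      have a: "inv_into I01 x z \<in> I01" using z B[OF h(1)] by (metis inv_into_into)
      then show b: "(inv_into I01 y \<circ> inv_into I01 x) z \<in> I01"
        using B[OF h(2)] by (metis inv_into_into comp_apply)
      show "compose I01 x y ((inv_into I01 y \<circ> inv_into I01 x) z) = z"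
        using a b z B[OF h(1)] B[OF h(2)] by (auto simp: compose_def f_inv_into_f)
    qed
    ultimately have 2: "C1_on_I (inv_into I01 (compose I01 x y))"
      by (subst C1_on_I_cong) auto
    have "x \<in> Bij I01" "y \<in> Bij I01" using h homeo_plus_I_subset_Bij by auto
    then have "x \<otimes>\<^bsub>BijGroup I01\<^esub> y = compose I01 x y" by (simp add: BijGroup_def)
    with 1 2 c show ?thesis by (simp add: diff1_plus_I_def)
  qed
  show "\<one>\<^bsub>BijGroup I01\<^esub> \<in> diff1_plus_I"
  proof -
    have "inv_into I01 (\<lambda>x\<in>I01. x) z = z" if "z \<in> I01" for z
      using that by (intro inv_into_f_eq) (auto simp: inj_on_def)
    then have "C1_on_I (inv_into I01 (\<lambda>x\<in>I01. x))" "C1_on_I (\<lambda>x\<in>I01. x)"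
      using C1_on_I_id by (subst C1_on_I_cong[of _ "\<lambda>x. x"]; simp)+
    then show ?thesis
      using homeo_plus_I_id by (simp add: BijGroup_def diff1_plus_I_def)
  qed
  show "inv\<^bsub>BijGroup I01\<^esub> x \<in> diff1_plus_I" if x: "x \<in> diff1_plus_I" for x
  proof -
    let ?g = "\<lambda>z\<in>I01. inv_into I01 x z"
    have h: "x \<in> homeo_plus_I" using x sub by auto
    have g: "?g \<in> homeo_plus_I" using h by (rule homeo_plus_I_inv)
    have "C1_on_I ?g"
      using x by (subst C1_on_I_cong[of _ "inv_into I01 x"]) (auto simp: diff1_plus_I_def)
    moreover have "inv_into I01 ?g z = x z" if "z \<in> I01" for z
      using that B[OF h] B[OF g] by (intro inv_into_f_eq) auto
    then have "C1_on_I (inv_into I01 ?g)"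
      using x by (subst C1_on_I_cong[of _ x]) (auto simp: diff1_plus_I_def)
    ultimately show ?thesis
      using g h homeo_plus_I_subset_Bij inv_BijGroup[of x I01] by (auto simp: diff1_plus_I_def)
  qed
qed

lemma group_Diff1_plus_I: "group Diff1_plus_I"
  unfolding Diff1_plus_I_def
  by (rule subgroup.subgroup_is_group[OF subgroup_diff1_plus_I group_BijGroup])

lemma equiv_iso_rel:
  assumes "group G"
  shows "equiv {S. subgroup S G} (iso_rel G)"
proof (rule equivI)
  show "iso_rel G \<subseteq> {S. subgroup S G} \<times> {S. subgroup S G}" by (auto simp: iso_rel_def)
  show "refl_on {S. subgroup S G} (iso_rel G)"
    by (auto simp: refl_on_def iso_rel_def iso_refl)
  show "sym (iso_rel G)"
    using assms by (auto simp: sym_def iso_rel_def intro: group.iso_sym subgroup.subgroup_is_group)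
  show "trans (iso_rel G)"
    by (auto simp: trans_def iso_rel_def intro: iso_trans)
qed

end

theory Submission
  imports Defs
begin

text \<open>The group of compactly supported homeomorphisms of the line is simple, and by a
  Loewenheim--Skolem closure every countable subset of a simple group lies in a countable simple
  subgroup. It therefore suffices to choose countable sets of homeomorphisms with suitable properties.

  The obstruction to \<open>C\<^sup>1\<close> actions is Thurston stability. The translation \<open>a\<close> by \<open>1/4\<close> and a certain
  piecewise linear \<open>b\<close> satisfy \<open>a\<^sup>4 = b\<^sup>3\<close> and \<open>(ba)\<^sup>5 = a\<^sup>1\<^sup>2\<close>; the abelianization of the group with these
  relations is trivial, since the determinant of \<open>4a = 3b\<close>, \<open>5b = 7a\<close> is \<open>-1\<close>. At a
  boundary point of the common fixed point set, \<open>C\<^sup>1\<close> diffeomorphisms satisfying the relations must have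
  derivative \<open>1\<close>, and then displacement is additive to first order, so it vanishes. Hence \<open>a\<close> acts
  trivially, and by simplicity so does any simple group containing \<open>a\<close> and \<open>b\<close>.

  For irrational \<open>\<alpha>\<close>, adjoin the translations by \<open>1\<close> and \<open>\<alpha>\<close> and a map supported on the unit
  interval. The set of \<open>(m, n)\<close> for which this map commutes with its conjugate by the translation by
  \<open>m\<alpha> - n\<close> determines \<open>\<alpha>\<close>. A countable group has only countably many triples of elements, so each
  isomorphism type is obtained for at most countably many \<open>\<alpha>\<close>.\<close>

section \<open>Homeomorphisms of the line\<close>

text \<open>A strictly increasing surjection of the line is automatically a homeomorphism, so order
  arguments can replace topology; continuity is extracted only for the passage to the
  interval.\<close>

definition homeo_R :: "(real \<Rightarrow> real) set" where
  "homeo_R = {f. strict_mono f \<and> surj f}"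

lemma homeo_R_I: "(\<And>x y. x < y \<Longrightarrow> f x < f y) \<Longrightarrow> (\<And>y. \<exists>x. f x = y) \<Longrightarrow> f \<in> homeo_R"
  unfolding homeo_R_def strict_mono_def surj_def by (auto simp: eq_commute)

lemma homeo_R_less: "f \<in> homeo_R \<Longrightarrow> f x < f y \<longleftrightarrow> x < y"
  by (simp add: homeo_R_def strict_mono_less)

lemma homeo_R_le: "f \<in> homeo_R \<Longrightarrow> f x \<le> f y \<longleftrightarrow> x \<le> y"
  by (simp add: homeo_R_def strict_mono_less_eq)

lemma homeo_R_eq: "f \<in> homeo_R \<Longrightarrow> f x = f y \<longleftrightarrow> x = y"
  by (simp add: homeo_R_def strict_mono_eq)

lemma homeo_R_surj: "f \<in> homeo_R \<Longrightarrow> \<exists>x. f x = y"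
  unfolding homeo_R_def surj_def by (auto simp: eq_commute)

lemma homeo_R_bij: "f \<in> homeo_R \<Longrightarrow> bij f"
  by (simp add: homeo_R_def bij_def strict_mono_imp_inj_on)

lemma homeo_R_inv_f: "f \<in> homeo_R \<Longrightarrow> inv_into UNIV f (f x) = x"
  by (simp add: homeo_R_bij bij_is_inj)

lemma homeo_R_f_inv: "f \<in> homeo_R \<Longrightarrow> f (inv_into UNIV f x) = x"
  by (simp add: homeo_R_bij bij_is_surj surj_f_inv_f)

lemma homeo_R_id: "id \<in> homeo_R"
  by (rule homeo_R_I) auto

lemma homeo_R_comp: "f \<in> homeo_R \<Longrightarrow> g \<in> homeo_R \<Longrightarrow> f \<circ> g \<in> homeo_R"
  by (rule homeo_R_I) (simp_all add: homeo_R_less, metis homeo_R_surj)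

lemma homeo_R_inv:
  assumes "f \<in> homeo_R" shows "inv_into UNIV f \<in> homeo_R"
proof (rule homeo_R_I)
  show "inv_into UNIV f x < inv_into UNIV f y" if "x < y" for x y
    using that homeo_R_less[OF assms, of "inv_into UNIV f x" "inv_into UNIV f y"] by (simp add: homeo_R_f_inv[OF assms])
  show "\<exists>x. inv_into UNIV f x = y" for y
    using homeo_R_inv_f[OF assms] by blast
qed

lemma homeo_R_affine:
  fixes c :: real assumes "c > 0" shows "(\<lambda>x. c * x + d) \<in> homeo_R"
proof (rule homeo_R_I)
  show "\<exists>x. c * x + d = y" for y
    using assms by (intro exI[of _ "(y - d) / c"]) simp
qed (simp add: assms)

lemma homeo_R_shift: "(\<lambda>x. x + d) \<in> homeo_R"
  using homeo_R_affine[of 1 d] by simp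

lemma homeo_R_continuous:
  assumes "f \<in> homeo_R" shows "continuous_on UNIV f"
proof (rule continuous_onI_mono)
  show "open (f ` UNIV)"
    using assms by (simp add: homeo_R_def)
  show "f x \<le> f y" if "x \<le> y" for x y
    using that assms by (simp add: homeo_R_le)
qed

lemma homeo_R_glue:
  assumes "f \<in> homeo_R" "g \<in> homeo_R" "f c = g c"
  shows "(\<lambda>x. if x \<le> c then f x else g x) \<in> homeo_R"
proof (rule homeo_R_I)
  show "(if x \<le> c then f x else g x) < (if y \<le> c then f y else g y)" if "x < y" for x y
    using that assms(3) homeo_R_le[OF assms(1), of x c] homeo_R_less[OF assms(2), of c y]
      homeo_R_less[OF assms(1), of x y] homeo_R_less[OF assms(2), of x y] by auto
  show "\<exists>x. (if x \<le> c then f x else g x) = y" for y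
  proof (cases "y \<le> f c")
    case True
    moreover obtain x where "f x = y" using homeo_R_surj[OF assms(1)] by blast
    ultimately show ?thesis using homeo_R_le[OF assms(1), of x c] by (intro exI[of _ x]) simp
  next
    case False
    moreover obtain x where "g x = y" using homeo_R_surj[OF assms(2)] by blast
    ultimately show ?thesis
      using homeo_R_le[OF assms(2), of x c] assms(3) by (intro exI[of _ x]) auto
  qed
qed

section \<open>Compactly supported homeomorphisms and two-point transitivity\<close>

definition homeo_c :: "(real \<Rightarrow> real) set" where
  "homeo_c = {f \<in> homeo_R. \<exists>r. \<forall>x. r \<le> \<bar>x\<bar> \<longrightarrow> f x = x}"

lemma homeo_c_R: "f \<in> homeo_c \<Longrightarrow> f \<in> homeo_R"
  by (simp add: homeo_c_def)

lemma homeo_c_id: "id \<in> homeo_c"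
  by (simp add: homeo_c_def homeo_R_id)

lemma homeo_c_comp:
  assumes "f \<in> homeo_c" "g \<in> homeo_c" shows "f \<circ> g \<in> homeo_c"
proof -
  obtain r s where "\<And>x. r \<le> \<bar>x\<bar> \<Longrightarrow> f x = x" "\<And>x. s \<le> \<bar>x\<bar> \<Longrightarrow> g x = x"
    using assms by (auto simp: homeo_c_def)
  then have "\<forall>x. max r s \<le> \<bar>x\<bar> \<longrightarrow> (f \<circ> g) x = x" by auto
  moreover have "f \<circ> g \<in> homeo_R" using assms homeo_c_R homeo_R_comp by blast
  ultimately show ?thesis unfolding homeo_c_def by blast
qed

lemma homeo_c_inv:
  assumes "f \<in> homeo_c" shows "inv_into UNIV f \<in> homeo_c"
proof -
  obtain r where r: "\<And>x. r \<le> \<bar>x\<bar> \<Longrightarrow> f x = x"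
    using assms by (auto simp: homeo_c_def)
  have "inv_into UNIV f x = x" if "r \<le> \<bar>x\<bar>" for x
    using homeo_R_inv_f[OF homeo_c_R[OF assms], of x] r[OF that] by simp
  moreover have "inv_into UNIV f \<in> homeo_R" using assms homeo_c_R homeo_R_inv by blast
  ultimately show ?thesis unfolding homeo_c_def by blast
qed

definition Homeo_c :: "(real \<Rightarrow> real) monoid" where
  "Homeo_c = \<lparr>carrier = homeo_c, mult = (\<circ>), one = id\<rparr>"

lemma Homeo_c_simps [simp]: "carrier Homeo_c = homeo_c" "f \<otimes>\<^bsub>Homeo_c\<^esub> g = f \<circ> g" "\<one>\<^bsub>Homeo_c\<^esub> = id"
  by (simp_all add: Homeo_c_def)

lemma group_Homeo_c: "group Homeo_c"
proof (rule groupI)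
  show "\<exists>y\<in>carrier Homeo_c. y \<otimes>\<^bsub>Homeo_c\<^esub> x = \<one>\<^bsub>Homeo_c\<^esub>" if "x \<in> carrier Homeo_c" for x
    using that by (intro bexI[of _ "inv_into UNIV x"]) (auto simp: homeo_c_inv homeo_R_inv_f homeo_c_R)
qed (auto simp: homeo_c_comp homeo_c_id)

lemma inv_Homeo_c:
  assumes "f \<in> homeo_c" shows "inv\<^bsub>Homeo_c\<^esub> f = inv_into UNIV f"
  using assms
  by (intro group.inv_equality[OF group_Homeo_c]) (auto simp: homeo_c_inv homeo_R_inv_f homeo_c_R)

text \<open>The map is piecewise affine with nodes \<open>-R\<close>, \<open>p\<close>,
  \<open>q\<close>, \<open>R\<close>, where \<open>R\<close> is so large that both ends can be kept
  fixed and the identity attached outside.\<close>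

lemma homeo_c_two_point_transitive:
  assumes "p < q" "p' < q'"
  obtains h where "h \<in> homeo_c" "h p = p'" "h q = q'"
proof -
  define R where "R = 1 + \<bar>p\<bar> + \<bar>q\<bar> + \<bar>p'\<bar> + \<bar>q'\<bar>"
  \<comment> \<open>\<open>l a b c d\<close> is the affine map taking \<open>a\<close> to
    \<open>c\<close> and \<open>b\<close> to \<open>d\<close>. The pieces are glued from right to
    left.\<close>
  define l where "l a b c d x = (d - c) / (b - a) * x + (c - (d - c) / (b - a) * a)" for a b c d x :: real
  have l: "l a b c d \<in> homeo_R" if "a < b" "c < d" for a b c d
    using that unfolding l_def by (intro homeo_R_affine) simp
  have l1: "l a b c d a = c" for a b c d by (simp add: l_def)
  have l2: "l a b c d b = d" if "a < b" for a b c d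
  proof -
    have "l a b c d b = (d - c) / (b - a) * (b - a) + c" unfolding l_def by (simp only: algebra_simps)
    then show ?thesis using that by simp
  qed
  have R: "-R < p" "-R < p'" "q < R" "q' < R" unfolding R_def by auto
  define h1 where "h1 x = (if x \<le> R then l q R q' R x else id x)" for x
  define h2 where "h2 x = (if x \<le> q then l p q p' q' x else h1 x)" for x
  define h3 where "h3 x = (if x \<le> p then l (-R) p (-R) p' x else h2 x)" for x
  define h where "h x = (if x \<le> -R then id x else h3 x)" for x
  have "h1 \<in> homeo_R" unfolding h1_def using R by (intro homeo_R_glue l homeo_R_id) (auto simp: l2)
  then have "h2 \<in> homeo_R"
    unfolding h2_def using R assms by (intro homeo_R_glue[OF l]) (simp_all add: l2 l1, simp add: l2 l1 h1_def)
  then have "h3 \<in> homeo_R"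
    unfolding h3_def using R assms by (intro homeo_R_glue[OF l]) (simp_all add: l2 l1, simp add: l2 l1 h2_def)
  then have "h \<in> homeo_R"
    unfolding h_def using R assms by (intro homeo_R_glue[OF homeo_R_id]) (simp_all add: l2 l1, simp add: l2 l1 h3_def)
  moreover have "h x = x" if "R + 1 \<le> \<bar>x\<bar>" for x
    using that R assms by (auto simp: h_def h3_def h2_def h1_def abs_if split: if_splits)
  ultimately have "h \<in> homeo_c" by (auto simp: homeo_c_def)
  moreover have "h p = p'" "h q = q'"
    using R assms by (auto simp: h_def h3_def h2_def l1 l2)
  ultimately show ?thesis by (rule that)
qed

section \<open>Transport of the line into the open unit interval\<close>

definition squeeze :: "real \<Rightarrow> real" where "squeeze x = 1 / (1 + exp (- x))"
definition stretch :: "real \<Rightarrow> real" where "stretch y = ln (y / (1 - y))"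

lemma squeeze_range: "0 < squeeze x" "squeeze x < 1"
  by (simp_all add: squeeze_def add_pos_pos)

lemma stretch_squeeze: "stretch (squeeze x) = x"
proof -
  have "1 + exp (- x) \<noteq> 0" by (smt (verit) exp_gt_zero)
  then have "squeeze x / (1 - squeeze x) = 1 / exp (- x)" by (simp add: squeeze_def divide_simps)
  then show ?thesis by (simp add: stretch_def exp_minus inverse_eq_divide)
qed

lemma squeeze_stretch: "0 < y \<Longrightarrow> y < 1 \<Longrightarrow> squeeze (stretch y) = y"
  by (simp add: squeeze_def stretch_def exp_minus divide_simps)

lemma squeeze_less: "squeeze x < squeeze y \<longleftrightarrow> x < y"
proof -
  have "squeeze x < squeeze y" if "x < y" for x y
    using that by (simp add: squeeze_def divide_strict_left_mono add_pos_pos)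
  then show ?thesis by (metis less_asym linorder_neqE)
qed

text \<open>Conjugation by the logistic function \<open>squeeze\<close>, a homeomorphism of the line
  onto (0, 1), extended by the identity. It turns any homeomorphism of the line, a translation say,
  into a compactly supported one, and later it carries the line into the interval.\<close>

definition push :: "(real \<Rightarrow> real) \<Rightarrow> real \<Rightarrow> real" where
  "push f x = (if 0 < x \<and> x < 1 then squeeze (f (stretch x)) else x)"

lemma push_squeeze: "push f (squeeze x) = squeeze (f x)"
  by (simp add: push_def squeeze_range stretch_squeeze)

lemma push_outside: "\<not> (0 < x \<and> x < 1) \<Longrightarrow> push f x = x"
  by (auto simp: push_def)

lemma push_range: "0 < x \<Longrightarrow> x < 1 \<Longrightarrow> 0 < push f x \<and> push f x < 1"
  by (simp add: push_def squeeze_range)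

lemma squeeze_cases:
  assumes "\<And>y. x = squeeze y \<Longrightarrow> P" "\<not> (0 < x \<and> x < 1) \<Longrightarrow> P" shows P
  using assms squeeze_stretch by metis

lemma push_comp: "push f \<circ> push g = push (f \<circ> g)"
proof
  fix x show "(push f \<circ> push g) x = push (f \<circ> g) x"
    by (rule squeeze_cases[of x]) (simp_all add: push_squeeze push_outside)
qed

lemma push_id: "push id = id"
  by (auto simp: push_def squeeze_stretch)

lemma push_inj: "push f = push g \<Longrightarrow> f = g"
  using push_squeeze stretch_squeeze by (metis ext)

lemma push_homeo_c:
  assumes "f \<in> homeo_R" shows "push f \<in> homeo_c"
proof -
  have "push f x < push f y" if xy: "x < y" for x y
  proof (cases x rule: squeeze_cases)
    case x: (1 x')
    show ?thesis
    proof (cases y rule: squeeze_cases)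
      case (1 y')
      then show ?thesis using xy assms x by (simp add: push_squeeze squeeze_less homeo_R_less)
    next
      case 2
      then show ?thesis
        using xy x squeeze_range[of x'] squeeze_range[of "f x'"] by (simp add: push_squeeze push_outside)
    qed
  next
    case x: 2
    show ?thesis
    proof (cases y rule: squeeze_cases)
      case (1 y')
      then show ?thesis
        using xy x squeeze_range[of y'] squeeze_range[of "f y'"] by (simp add: push_squeeze push_outside)
    next
      case 2
      then show ?thesis using xy x by (simp add: push_outside)
    qed
  qed
  moreover have "\<exists>x. push f x = y" for y
  proof (cases y rule: squeeze_cases)
    case (1 z)
    then show ?thesis using homeo_R_surj[OF assms, of z] push_squeeze by metis
  next
    case 2
    then show ?thesis using push_outside by blast
  qed
  ultimately have "push f \<in> homeo_R" by (rule homeo_R_I)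
  moreover have "\<forall>x. 1 \<le> \<bar>x\<bar> \<longrightarrow> push f x = x" by (auto intro!: push_outside)
  ultimately show ?thesis by (auto simp: homeo_c_def)
qed

section \<open>Simplicity of the compactly supported homeomorphisms\<close>

text \<open>Put \<open>b = a \<otimes> inv u \<otimes> inv a\<close> and
  \<open>w = u \<otimes> b\<close>. Since \<open>b\<close> commutes with \<open>v\<close>, the
  commutators of \<open>u\<close> and of \<open>w\<close> with \<open>v\<close> agree; and
  \<open>w\<close> is itself the commutator of \<open>u\<close> and \<open>a\<close>, hence in
  \<open>H\<close>.\<close>

lemma (in normal) commutator_mem:
  assumes a: "a \<in> H" and uv: "u \<in> carrier G" "v \<in> carrier G"
    and comm: "(a \<otimes> inv u \<otimes> inv a) \<otimes> v = v \<otimes> (a \<otimes> inv u \<otimes> inv a)"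
  shows "u \<otimes> v \<otimes> inv u \<otimes> inv v \<in> H"
proof -
  define b where "b = a \<otimes> inv u \<otimes> inv a"
  have aG: "a \<in> carrier G" using a by (rule mem_carrier)
  then have bG: "b \<in> carrier G" using uv by (simp add: b_def)
  define w where "w = u \<otimes> b"
  have "w = (u \<otimes> a \<otimes> inv u) \<otimes> inv a"
    using uv aG by (simp add: w_def b_def m_assoc)
  then have wH: "w \<in> H" using a uv inv_op_closed2 by simp
  then have wG: "w \<in> carrier G" by (rule mem_carrier)
  have "w \<otimes> v = u \<otimes> v \<otimes> b"
    using comm uv bG by (simp add: w_def m_assoc b_def[symmetric])
  then have "w \<otimes> v \<otimes> inv w = u \<otimes> v \<otimes> b \<otimes> inv w" by simp
  also have "\<dots> = u \<otimes> v \<otimes> inv u"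
    using uv bG by (simp add: w_def m_assoc inv_mult_group) (simp add: m_assoc[symmetric])
  finally have "u \<otimes> v \<otimes> inv u \<otimes> inv v = w \<otimes> (v \<otimes> inv w \<otimes> inv v)"
    using uv wG by (simp add: m_assoc[symmetric])
  also have "\<dots> \<in> H" using wH uv inv_op_closed2 by simp
  finally show ?thesis .
qed

text \<open>The map \<open>u\<close> is the infinite product of the translates of \<open>g\<close> by the natural numbers, so that
  \<open>g\<close> is the commutator of \<open>u\<close> and the unit translation.\<close>

lemma unit_interval_homeo_telescopes:
  assumes g: "g \<in> homeo_R" and supp: "\<And>x. \<not> (0 < x \<and> x < 1) \<Longrightarrow> g x = x"
  obtains u where "u \<in> homeo_R" "\<And>x. u (x + 1) = g (u x + 1)"
proof -
  define u where "u x = (if x < 0 then x else of_int \<lfloor>x\<rfloor> + g (x - of_int \<lfloor>x\<rfloor>))" for x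
  have g01: "0 \<le> g y \<and> g y < 1" if "0 \<le> y" "y < 1" for y
    using that homeo_R_le[OF g, of 0 y] homeo_R_less[OF g, of y 1] supp[of 0] supp[of 1] by simp
  have u: "u (of_int n + y) = of_int n + g y" if "0 \<le> n" "0 \<le> y" "y < 1" for n y
  proof -
    have "\<lfloor>of_int n + y\<rfloor> = n" using that by (simp add: floor_unique)
    then show ?thesis using that by (simp add: u_def)
  qed
  have nonneg: "\<exists>n y. x = of_int n + y \<and> 0 \<le> n \<and> 0 \<le> y \<and> y < 1" if "0 \<le> x" for x :: real
    using that by (intro exI[of _ "\<lfloor>x\<rfloor>"] exI[of _ "x - of_int \<lfloor>x\<rfloor>"]) (auto, linarith)
  have neg: "u x = x" if "x < 0" for x using that by (simp add: u_def)
  have "u x < u y" if xy: "x < y" for x y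
  proof (cases "0 \<le> x")
    case True
    then obtain m r where x: "x = of_int m + r" "0 \<le> m" "0 \<le> r" "r < 1" using nonneg by blast
    obtain n s where y: "y = of_int n + s" "0 \<le> n" "0 \<le> s" "s < 1" using nonneg True xy by (meson order.strict_implies_order order_trans)
    have "m \<le> n" using x y xy by linarith
    show ?thesis
    proof (cases "m = n")
      case True
      then show ?thesis using x y xy u homeo_R_less[OF g, of r s] by simp
    next
      case False
      then have "of_int m + 1 \<le> (of_int n :: real)" using \<open>m \<le> n\<close> by linarith
      then show ?thesis using x y u g01[of r] g01[of s] by simp
    qed
  next
    case False
    show ?thesis
    proof (cases "0 \<le> y")
      case True
      then obtain n s where y: "y = of_int n + s" "0 \<le> n" "0 \<le> s" "s < 1" using nonneg by blast
      then have "0 \<le> u y" using u g01[of s] by simp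
      then show ?thesis using False neg by simp
    qed (use False neg xy in simp)
  qed
  moreover have "\<exists>x. u x = y" for y
  proof (cases "0 \<le> y")
    case True
    then obtain n s where y: "y = of_int n + s" "0 \<le> n" "0 \<le> s" "s < 1" using nonneg by blast
    obtain r where r: "g r = s" using homeo_R_surj[OF g] by blast
    have "0 \<le> r" "r < 1"
      using y r homeo_R_le[OF g, of 0 r] homeo_R_less[OF g, of r 1] supp[of 0] supp[of 1] by auto
    then show ?thesis using u[of n r] y r by auto
  qed (use neg in \<open>auto intro: exI[of _ y]\<close>)
  ultimately have "u \<in> homeo_R" by (rule homeo_R_I)
  \<comment> \<open>The factor \<open>g\<close> acts only for \<open>x\<close> in [-1, 0), where
    \<open>u\<close> is still the identity. To the right \<open>u x + 1\<close> is at least 1 and to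
    the left it is negative, both outside the support of \<open>g\<close>.\<close>
  moreover have "u (x + 1) = g (u x + 1)" for x
  proof -
    consider "0 \<le> x" | "-1 \<le> x" "x < 0" | "x < -1" by linarith
    then show ?thesis
    proof cases
      case 1
      then obtain n s where x: "x = of_int n + s" "0 \<le> n" "0 \<le> s" "s < 1" using nonneg by blast
      have "u (x + 1) = u x + 1"
        using u[of "n + 1" s] u[of n s] x by (simp add: algebra_simps)
      moreover have "0 \<le> u x" using u[of n s] x g01[of s] by simp
      ultimately show ?thesis using supp[of "u x + 1"] by simp
    next
      case 2
      then show ?thesis using u[of 0 "x + 1"] neg[of x] by simp
    next
      case 3
      then show ?thesis using neg supp by simp
    qed
  qed
  ultimately show thesis by (rule that)
qed

lemma push_mem_Homeo_c: "f \<in> homeo_R \<Longrightarrow> push f \<in> carrier Homeo_c"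
  by (simp add: push_homeo_c)

lemma push_inv_Homeo_c:
  assumes "f \<in> homeo_R" shows "inv\<^bsub>Homeo_c\<^esub> (push f) = push (inv_into UNIV f)"
proof (rule group.inv_equality[OF group_Homeo_c])
  have "inv_into UNIV f \<circ> f = id" using homeo_R_inv_f[OF assms] by auto
  then show "push (inv_into UNIV f) \<otimes>\<^bsub>Homeo_c\<^esub> push f = \<one>\<^bsub>Homeo_c\<^esub>" by (simp add: push_comp push_id)
qed (simp_all add: push_homeo_c assms homeo_R_inv)

lemma Homeo_c_inv_apply:
  assumes "f \<in> homeo_c"
  shows "(inv\<^bsub>Homeo_c\<^esub> f) (f x) = x" "f ((inv\<^bsub>Homeo_c\<^esub> f) x) = x"
  using assms by (simp_all add: inv_Homeo_c homeo_R_inv_f homeo_R_f_inv homeo_c_R)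

text \<open>Both pushed maps are supported in the unit interval. Since \<open>a\<close> moves this
  interval off itself, conjugating one of them by \<open>a\<close> gives a map with support disjoint
  from that of the other, so the two commute.\<close>

lemma commutator_of_displaced:
  assumes N: "N \<lhd> Homeo_c" and a: "a \<in> N" "\<And>y. 0 \<le> y \<Longrightarrow> y \<le> 1 \<Longrightarrow> \<not> (0 \<le> a y \<and> a y \<le> 1)"
    and uv: "u \<in> homeo_R" "v \<in> homeo_R"
  shows "push u \<otimes>\<^bsub>Homeo_c\<^esub> push v \<otimes>\<^bsub>Homeo_c\<^esub> inv\<^bsub>Homeo_c\<^esub> (push u) \<otimes>\<^bsub>Homeo_c\<^esub> inv\<^bsub>Homeo_c\<^esub> (push v) \<in> N"
proof -
  interpret N: normal N Homeo_c by (rule N)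
  have ac: "a \<in> homeo_c" using N.mem_carrier[OF a(1)] by simp
  let ?a' = "inv\<^bsub>Homeo_c\<^esub> a"
  define b where "b = a \<otimes>\<^bsub>Homeo_c\<^esub> inv\<^bsub>Homeo_c\<^esub> (push u) \<otimes>\<^bsub>Homeo_c\<^esub> ?a'"
  have b: "b y = a (push (inv_into UNIV u) (?a' y))" for y
    using uv by (simp add: b_def push_inv_Homeo_c)
  have bR: "b \<in> homeo_R"
    using ac uv by (intro homeo_c_R) (simp add: b_def push_inv_Homeo_c inv_Homeo_c homeo_c_comp homeo_c_inv push_homeo_c homeo_R_inv)
  have b01: "b y = y" if y: "0 \<le> y" "y \<le> 1" for y
  proof -
    have "\<not> (0 \<le> ?a' y \<and> ?a' y \<le> 1)" using a(2)[of "?a' y"] y Homeo_c_inv_apply(2)[OF ac, of y] by auto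
    then have "push (inv_into UNIV u) (?a' y) = ?a' y" by (intro push_outside) auto
    then show ?thesis using b Homeo_c_inv_apply(2)[OF ac] by simp
  qed
  have "b (push v x) = push v (b x)" for x
  proof (cases "0 < x \<and> x < 1")
    case True
    then show ?thesis using push_range[of x v] b01[of x] b01[of "push v x"] by simp
  next
    case False
    \<comment> \<open>Otherwise \<open>b\<close> would fix \<open>b x\<close>, and injectivity would
      give \<open>b x = x\<close>, a point outside (0, 1).\<close>
    have "\<not> (0 < b x \<and> b x < 1)"
      using b01[of "b x"] homeo_R_eq[OF bR, of "b x" x] False by auto
    then show ?thesis using False by (simp add: push_outside)
  qed
  then have comm: "b \<otimes>\<^bsub>Homeo_c\<^esub> push v = push v \<otimes>\<^bsub>Homeo_c\<^esub> b" by (auto simp: fun_eq_iff)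
  show ?thesis
    by (rule N.commutator_mem[OF a(1) push_mem_Homeo_c[OF uv(1)] push_mem_Homeo_c[OF uv(2)]])
      (use comm in \<open>simp only: b_def\<close>)
qed

text \<open>If \<open>x < a x\<close>, choose \<open>q\<close> strictly between: by monotonicity all
  points from \<open>x\<close> onwards land beyond \<open>q\<close>. The other case is
  symmetric.\<close>

lemma homeo_R_displaces_interval:
  assumes a: "a \<in> homeo_R" "a \<noteq> id"
  obtains p q where "p < q" "\<And>y. p \<le> y \<Longrightarrow> y \<le> q \<Longrightarrow> \<not> (p \<le> a y \<and> a y \<le> q)"
proof -
  obtain x where x: "a x \<noteq> x" using a(2) by (auto simp: fun_eq_iff)
  show thesis
  proof (cases "x < a x")
    case True
    then obtain q where q: "x < q" "q < a x" using dense by blast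
    have "q < a y" if "x \<le> y" for y using q that homeo_R_le[OF a(1), of x y] by linarith
    then show thesis using that[of x q] q by force
  next
    case False
    then obtain p where p: "a x < p" "p < x" using dense x by (metis linorder_neqE)
    have "a y < p" if "y \<le> x" for y using p that homeo_R_le[OF a(1), of y x] by linarith
    then show thesis using that[of p x] p by force
  qed
qed

text \<open>Undoing \<open>push\<close> on a map with this support yields a homeomorphism supported
  in the unit interval, the form in which it can be telescoped into a commutator.\<close>

lemma conj_push:
  assumes "f \<in> homeo_R" "\<And>x. x \<notin> {squeeze 0..squeeze 1} \<Longrightarrow> f x = x"
  obtains g where "g \<in> homeo_R" "\<And>x. \<not> (0 < x \<and> x < 1) \<Longrightarrow> g x = x" "f = push g"
proof -
  define g where "g = (\<lambda>x. stretch (f (squeeze x)))"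
  have f0: "f x = x" if "\<not> (squeeze 0 < x \<and> x < squeeze 1)" for x
  proof -
    \<comment> \<open>The hypothesis is silent about the end points. A moved end point would share
      its image with a fixed point outside the interval, or be the image of such a point, against
      injectivity or the choice of that point.\<close>
    have "f (squeeze 0) = squeeze 0"
    proof (rule ccontr)
      assume "f (squeeze 0) \<noteq> squeeze 0"
      then consider "f (squeeze 0) < squeeze 0" | "squeeze 0 < f (squeeze 0)" by linarith
      then show False
      proof cases
        case 1
        then have "f (f (squeeze 0)) = f (squeeze 0)" by (intro assms(2)) auto
        then show False using 1 homeo_R_eq[OF assms(1)] by auto
      next
        case 2
        obtain y where y: "f y = squeeze 0" using homeo_R_surj[OF assms(1)] by blast
        then have "y < squeeze 0" using 2 homeo_R_less[OF assms(1), of y "squeeze 0"] by simp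
        then show False using assms(2)[of y] y by auto
      qed
    qed
    moreover have "f (squeeze 1) = squeeze 1"
    proof (rule ccontr)
      assume "f (squeeze 1) \<noteq> squeeze 1"
      then consider "f (squeeze 1) > squeeze 1" | "squeeze 1 > f (squeeze 1)" by linarith
      then show False
      proof cases
        case 1
        then have "f (f (squeeze 1)) = f (squeeze 1)" by (intro assms(2)) auto
        then show False using 1 homeo_R_eq[OF assms(1)] by auto
      next
        case 2
        obtain y where y: "f y = squeeze 1" using homeo_R_surj[OF assms(1)] by blast
        then have "y > squeeze 1" using 2 homeo_R_less[OF assms(1), of "squeeze 1" y] by simp
        then show False using assms(2)[of y] y by auto
      qed
    qed
    ultimately show ?thesis using assms(2)[of x] that by (cases "x = squeeze 0 \<or> x = squeeze 1") auto
  qed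
  have f01: "0 < f x \<and> f x < 1" if "0 < x" "x < 1" for x
    using that homeo_R_less[OF assms(1), of 0 x] homeo_R_less[OF assms(1), of x 1] f0[of 0] f0[of 1]
      squeeze_range[of 0] squeeze_range[of 1] by simp
  then have sq: "squeeze (g x) = f (squeeze x)" for x
    using squeeze_range[of x] by (simp add: g_def squeeze_stretch)
  have "f = push g"
  proof
    fix x show "f x = push g x"
    proof (cases x rule: squeeze_cases)
      case 1
      then show ?thesis by (simp add: push_squeeze sq)
    next
      case 2
      then show ?thesis using f0[of x] squeeze_range[of 0] squeeze_range[of 1]
        by (simp add: push_outside) linarith
    qed
  qed
  moreover have "g \<in> homeo_R"
  proof (rule homeo_R_I)
    show "g x < g y" if "x < y" for x y
      using that squeeze_less homeo_R_less[OF assms(1)] sq by metis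
    show "\<exists>x. g x = y" for y
    proof -
      obtain z where z: "f z = squeeze y" using homeo_R_surj[OF assms(1)] by blast
      show ?thesis
      proof (cases z rule: squeeze_cases)
        case (1 x)
        then have "squeeze (g x) = squeeze y" using z sq by simp
        then show ?thesis using stretch_squeeze by metis
      next
        case 2
        then have "f z = z" using f0[of z] squeeze_range[of 0] squeeze_range[of 1] by linarith
        then show ?thesis using 2 z squeeze_range[of y] by simp
      qed
    qed
  qed
  moreover have "g x = x" if "\<not> (0 < x \<and> x < 1)" for x
    using that f0[of "squeeze x"] by (simp add: g_def squeeze_less stretch_squeeze)
  ultimately show thesis by (intro that)
qed

text \<open>A nontrivial normal subgroup has an element displacing some interval, and by two-point
  transitivity one displacing [0, 1]. Any \<open>g\<close> is conjugate to a pushed map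
  \<open>g1\<close> whose preimage under \<open>push\<close> lives in the unit interval. Telescoping
  makes \<open>g1\<close> the commutator of two pushed maps, so \<open>g1\<close> and then
  \<open>g\<close> lie in the subgroup.\<close>

lemma is_simple_Homeo_c: "is_simple Homeo_c"
proof -
  have "push (\<lambda>x. x + 1) \<noteq> id"
    using push_inj[of "\<lambda>x. x + 1" id] push_id by (auto simp: fun_eq_iff)
  then have "carrier Homeo_c \<noteq> {\<one>\<^bsub>Homeo_c\<^esub>}" using push_mem_Homeo_c[OF homeo_R_shift[of 1]] by auto
  moreover have "N = carrier Homeo_c" if N: "N \<lhd> Homeo_c" and ne: "N \<noteq> {\<one>\<^bsub>Homeo_c\<^esub>}" for N
  proof -
    interpret N: normal N Homeo_c by (rule N)
    obtain a where a: "a \<in> N" "a \<noteq> id" using ne subgroup.one_closed[OF N.subgroup_axioms] by auto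
    have ac: "a \<in> homeo_c" using N.mem_carrier[OF a(1)] by simp
    obtain p q where pq: "p < q" "\<And>y. p \<le> y \<Longrightarrow> y \<le> q \<Longrightarrow> \<not> (p \<le> a y \<and> a y \<le> q)"
      using homeo_R_displaces_interval[OF homeo_c_R[OF ac] a(2)] by blast
    obtain h where h: "h \<in> homeo_c" "h p = 0" "h q = 1"
      using homeo_c_two_point_transitive[OF pq(1), of 0 1] by auto
    define a1 where "a1 = h \<otimes>\<^bsub>Homeo_c\<^esub> a \<otimes>\<^bsub>Homeo_c\<^esub> inv\<^bsub>Homeo_c\<^esub> h"
    have a1: "a1 \<in> N" unfolding a1_def using h a by (intro N.inv_op_closed2) auto
    have disp: "\<not> (0 \<le> a1 y \<and> a1 y \<le> 1)" if y: "0 \<le> y" "y \<le> 1" for y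
    proof -
      have hl: "0 \<le> h z \<and> h z \<le> 1 \<longleftrightarrow> p \<le> z \<and> z \<le> q" for z
        using homeo_R_le[OF homeo_c_R[OF h(1)], of p z] homeo_R_le[OF homeo_c_R[OF h(1)], of z q] h by simp
      have "p \<le> (inv\<^bsub>Homeo_c\<^esub> h) y \<and> (inv\<^bsub>Homeo_c\<^esub> h) y \<le> q"
        using hl[of "(inv\<^bsub>Homeo_c\<^esub> h) y"] y Homeo_c_inv_apply(2)[OF h(1)] by simp
      then show ?thesis using pq(2) hl by (simp add: a1_def)
    qed
    have "g \<in> N" if g: "g \<in> homeo_c" for g
    proof -
      obtain r where r: "\<And>x. r \<le> \<bar>x\<bar> \<Longrightarrow> g x = x" using g by (auto simp: homeo_c_def)
      \<comment> \<open>The maximum ensures \<open>-r' < r'\<close>, as \<open>r\<close> itself may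
        be negative or zero.\<close>
      define r' where "r' = max r 1"
      have r': "-r' < r'" by (simp add: r'_def)
      obtain k where k: "k \<in> homeo_c" "k (-r') = squeeze 0" "k r' = squeeze 1"
        using homeo_c_two_point_transitive[OF r', of "squeeze 0" "squeeze 1"] squeeze_less[of 0 1] by auto
      define g1 where "g1 = k \<otimes>\<^bsub>Homeo_c\<^esub> g \<otimes>\<^bsub>Homeo_c\<^esub> inv\<^bsub>Homeo_c\<^esub> k"
      have g1c: "g1 \<in> carrier Homeo_c" unfolding g1_def using k g by (intro N.m_closed N.inv_closed) auto
      have "g1 x = x" if x: "x \<notin> {squeeze 0..squeeze 1}" for x
      proof -
        define y where "y = (inv\<^bsub>Homeo_c\<^esub> k) x"
        have ky: "k y = x" using Homeo_c_inv_apply(2)[OF k(1)] by (simp add: y_def)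
        have "\<not> (-r' \<le> y \<and> y \<le> r')"
          using x ky k homeo_R_le[OF homeo_c_R[OF k(1)], of "-r'" y] homeo_R_le[OF homeo_c_R[OF k(1)], of y r'] by auto
        then have "g y = y" by (intro r) (auto simp: r'_def)
        then show ?thesis using ky by (simp add: g1_def y_def)
      qed
      then obtain g2 where g2: "g2 \<in> homeo_R" "\<And>x. \<not> (0 < x \<and> x < 1) \<Longrightarrow> g2 x = x" "g1 = push g2"
        using conj_push[of g1] g1c homeo_c_R by auto
      obtain u where u: "u \<in> homeo_R" "\<And>x. u (x + 1) = g2 (u x + 1)"
        using unit_interval_homeo_telescopes[OF g2(1,2)] by blast
      let ?T = "\<lambda>x::real. x + 1"
      have "u \<circ> ?T = g2 \<circ> (?T \<circ> u)" using u(2) by auto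
      then have "push u \<otimes>\<^bsub>Homeo_c\<^esub> push ?T = g1 \<otimes>\<^bsub>Homeo_c\<^esub> (push ?T \<otimes>\<^bsub>Homeo_c\<^esub> push u)"
        by (simp add: g2 push_comp)
      then have "g1 = push u \<otimes>\<^bsub>Homeo_c\<^esub> push ?T \<otimes>\<^bsub>Homeo_c\<^esub> inv\<^bsub>Homeo_c\<^esub> (push ?T \<otimes>\<^bsub>Homeo_c\<^esub> push u)"
        using g1c push_mem_Homeo_c[OF u(1)] push_mem_Homeo_c[OF homeo_R_shift] by (metis N.inv_solve_right N.m_closed)
      also have "\<dots> = push u \<otimes>\<^bsub>Homeo_c\<^esub> push ?T \<otimes>\<^bsub>Homeo_c\<^esub> inv\<^bsub>Homeo_c\<^esub> (push u) \<otimes>\<^bsub>Homeo_c\<^esub> inv\<^bsub>Homeo_c\<^esub> (push ?T)"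
        using N.inv_mult_group[OF push_mem_Homeo_c[OF homeo_R_shift] push_mem_Homeo_c[OF u(1)]] by (simp add: o_assoc)
      also have "\<dots> \<in> N" by (rule commutator_of_displaced[OF N a1 disp u(1) homeo_R_shift])
      finally have "g1 \<in> N" .
      moreover have "k \<in> carrier Homeo_c" "g \<in> carrier Homeo_c" using k g by auto
      ultimately have "inv\<^bsub>Homeo_c\<^esub> k \<otimes>\<^bsub>Homeo_c\<^esub> g1 \<otimes>\<^bsub>Homeo_c\<^esub> k \<in> N" by (intro N.inv_op_closed1)
      moreover have "inv\<^bsub>Homeo_c\<^esub> k \<otimes>\<^bsub>Homeo_c\<^esub> g1 \<otimes>\<^bsub>Homeo_c\<^esub> k = g"
        using Homeo_c_inv_apply[OF k(1)] by (auto simp: g1_def fun_eq_iff)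
      ultimately show ?thesis by simp
    qed
    then show ?thesis using N.subset by auto
  qed
  ultimately show ?thesis using group_Homeo_c unfolding is_simple_def by blast
qed

section \<open>Countable simple subgroups\<close>

lemma is_simpleD:
  assumes "is_simple G" "H \<lhd> G" "a \<in> H" "a \<noteq> \<one>\<^bsub>G\<^esub>"
  shows "H = carrier G"
  using assms unfolding is_simple_def by blast

lemma (in group) generate_finitely_generated:
  assumes "b \<in> generate G A"
  shows "\<exists>A'. finite A' \<and> A' \<subseteq> A \<and> b \<in> generate G A'"
  using assms
proof induction
  case one
  then show ?case by (intro exI[of _ "{}"]) (auto intro: generate.one)
next
  case (incl h)
  then show ?case by (intro exI[of _ "{h}"]) (auto intro: generate.incl)
next
  case (inv h)
  then show ?case by (intro exI[of _ "{h}"]) (auto intro: generate.inv)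
next
  case (eng h1 h2)
  then obtain A1 A2 where "finite A1" "A1 \<subseteq> A" "h1 \<in> generate G A1"
    and "finite A2" "A2 \<subseteq> A" "h2 \<in> generate G A2" by blast
  then show ?case
    using mono_generate[of A1 "A1 \<union> A2"] mono_generate[of A2 "A1 \<union> A2"]
    by (intro exI[of _ "A1 \<union> A2"]) (auto intro: generate.eng)
qed

text \<open>This is the normal closure of \<open>a\<close>; in a simple group it is everything as
  soon as \<open>a\<close> is not the identity.\<close>

lemma (in group) normal_generate_conjugates:
  assumes a: "a \<in> carrier G"
  shows "generate G ((\<lambda>k. k \<otimes> a \<otimes> inv k) ` carrier G) \<lhd> G"
proof -
  let ?A = "(\<lambda>k. k \<otimes> a \<otimes> inv k) ` carrier G"
  have A: "?A \<subseteq> carrier G" using a by auto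
  have "g \<otimes> h \<otimes> inv g \<in> generate G ?A" if g: "g \<in> carrier G" and "h \<in> generate G ?A" for g h
    using that(2)
  proof induction
    case one
    then show ?case using g by (simp add: generate.one)
  next
    case (incl h)
    then obtain k where k: "k \<in> carrier G" "h = k \<otimes> a \<otimes> inv k" by blast
    then have "g \<otimes> h \<otimes> inv g = (g \<otimes> k) \<otimes> a \<otimes> inv (g \<otimes> k)"
      using g a by (simp add: m_assoc inv_mult_group)
    moreover have "(g \<otimes> k) \<otimes> a \<otimes> inv (g \<otimes> k) \<in> ?A" using g k by blast
    ultimately show ?case by (simp only: generate.incl)
  next
    case (inv h)
    then obtain k where k: "k \<in> carrier G" "h = k \<otimes> a \<otimes> inv k" by blast
    then have "g \<otimes> inv h \<otimes> inv g = inv ((g \<otimes> k) \<otimes> a \<otimes> inv (g \<otimes> k))"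
      using g a by (simp add: m_assoc inv_mult_group)
    moreover have "(g \<otimes> k) \<otimes> a \<otimes> inv (g \<otimes> k) \<in> ?A" using g k by blast
    ultimately show ?case by (simp only: generate.inv)
  next
    case (eng h1 h2)
    have c: "h1 \<in> carrier G" "h2 \<in> carrier G"
      using eng.hyps A generate_in_carrier by auto
    have "inv g \<otimes> (g \<otimes> x) = x" if "x \<in> carrier G" for x
      using that g by (simp add: m_assoc[symmetric])
    then have "g \<otimes> (h1 \<otimes> h2) \<otimes> inv g = (g \<otimes> h1 \<otimes> inv g) \<otimes> (g \<otimes> h2 \<otimes> inv g)"
      using g c by (simp add: m_assoc)
    then show ?case using eng.IH by (simp only: generate.eng)
  qed
  then show ?thesis
    using generate_is_subgroup[OF A] by (auto simp: normal_inv_iff)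
qed

text \<open>A set-valued \<open>F\<close> allows closing under products, inverses and chosen
  conjugators at once. The stages of the iteration increase, so any two elements of the union
  already occur in a common stage.\<close>

lemma countable_closure:
  fixes F :: "'a \<Rightarrow> 'a \<Rightarrow> 'a set"
  assumes "countable C" "C \<subseteq> U" "\<And>a b. a \<in> U \<Longrightarrow> b \<in> U \<Longrightarrow> countable (F a b) \<and> F a b \<subseteq> U"
  obtains S where "C \<subseteq> S" "S \<subseteq> U" "countable S" "\<forall>a\<in>S. \<forall>b\<in>S. F a b \<subseteq> S"
proof -
  define T where "T = rec_nat C (\<lambda>_ S. S \<union> (\<Union>a\<in>S. \<Union>b\<in>S. F a b))"
  have T0: "T 0 = C" and TS: "\<And>n. T (Suc n) = T n \<union> (\<Union>a\<in>T n. \<Union>b\<in>T n. F a b)"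
    by (simp_all add: T_def)
  have *: "countable (T n) \<and> T n \<subseteq> U" for n
  proof (induction n)
    case 0
    then show ?case using assms by (simp add: T0)
  next
    case (Suc n)
    then have "countable (F a b) \<and> F a b \<subseteq> U" if "a \<in> T n" "b \<in> T n" for a b
      using assms(3) that by blast
    with Suc show ?case unfolding TS by (simp add: UN_least)
  qed
  have mono: "T m \<subseteq> T n" if "m \<le> n" for m n
    using lift_Suc_mono_le[of T] TS that by blast
  show thesis
  proof
    show "C \<subseteq> (\<Union>n. T n)" using T0 by blast
    show "(\<Union>n. T n) \<subseteq> U" "countable (\<Union>n. T n)" using * by auto
    show "\<forall>a\<in>\<Union>n. T n. \<forall>b\<in>\<Union>n. T n. F a b \<subseteq> (\<Union>n. T n)"
    proof (intro ballI)
      fix a b assume ab: "a \<in> (\<Union>n. T n)" "b \<in> (\<Union>n. T n)"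
      obtain m n where mn: "a \<in> T m" "b \<in> T n" using ab by blast
      have "a \<in> T (max m n)" "b \<in> T (max m n)"
        using mn mono[of m "max m n"] mono[of n "max m n"] by auto
      then have "F a b \<subseteq> (\<Union>a\<in>T (max m n). \<Union>b\<in>T (max m n). F a b)" by (intro SUP_upper2[of a] SUP_upper2[of b]) auto
      then have "F a b \<subseteq> T (Suc (max m n))" unfolding TS by (rule le_supI2)
      then show "F a b \<subseteq> (\<Union>n. T n)" by (rule SUP_upper2[OF UNIV_I])
    qed
  qed
qed

text \<open>Close up under, for each pair \<open>a \<noteq> \<one>\<close> and \<open>b\<close>, finitely many elements conjugating \<open>a\<close> to
  generators of a subgroup containing \<open>b\<close>.\<close>

lemma countable_simple_subgroup:
  assumes G: "is_simple G" and C: "countable C" "C \<subseteq> carrier G" and c: "c \<in> C" "c \<noteq> \<one>\<^bsub>G\<^esub>"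
  obtains S where "subgroup S G" "C \<subseteq> S" "countable S" "is_simple (G\<lparr>carrier := S\<rparr>)"
proof -
  interpret group G using G by (simp add: is_simple_def)
  define K where "K a b = (SOME K. finite K \<and> K \<subseteq> carrier G \<and> b \<in> generate G ((\<lambda>k. k \<otimes>\<^bsub>G\<^esub> a \<otimes>\<^bsub>G\<^esub> inv\<^bsub>G\<^esub> k) ` K))" for a b
  have K: "finite (K a b) \<and> K a b \<subseteq> carrier G \<and> b \<in> generate G ((\<lambda>k. k \<otimes>\<^bsub>G\<^esub> a \<otimes>\<^bsub>G\<^esub> inv\<^bsub>G\<^esub> k) ` K a b)"
    if ab: "a \<in> carrier G" "b \<in> carrier G" "a \<noteq> \<one>\<^bsub>G\<^esub>" for a b
  proof -
    let ?c = "\<lambda>k. k \<otimes>\<^bsub>G\<^esub> a \<otimes>\<^bsub>G\<^esub> inv\<^bsub>G\<^esub> k"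
    have "a \<in> ?c ` carrier G" by (rule image_eqI[of _ _ "\<one>\<^bsub>G\<^esub>"]) (use ab in simp_all)
    then have "a \<in> generate G (?c ` carrier G)" by (rule generate.incl)
    then have "b \<in> generate G (?c ` carrier G)"
      using is_simpleD[OF G normal_generate_conjugates[OF ab(1)]] ab by blast
    then obtain A where A: "finite A" "A \<subseteq> ?c ` carrier G" "b \<in> generate G A"
      using generate_finitely_generated by blast
    obtain L where "finite L" "L \<subseteq> carrier G" "A = ?c ` L"
      using finite_subset_image[OF A(1,2)] by blast
    then have "\<exists>K. finite K \<and> K \<subseteq> carrier G \<and> b \<in> generate G (?c ` K)" using A by blast
    then show ?thesis unfolding K_def by (rule someI_ex)
  qed
  \<comment> \<open>The first part makes the closure a subgroup, the second supplies the
    conjugators. For the identity there are none to choose, since its conjugates generate only the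
    trivial group.\<close>
  define F where "F a b = {a \<otimes>\<^bsub>G\<^esub> b, inv\<^bsub>G\<^esub> a} \<union> (if a = \<one>\<^bsub>G\<^esub> then {} else K a b)" for a b
  have F: "countable (F a b) \<and> F a b \<subseteq> carrier G" if "a \<in> carrier G" "b \<in> carrier G" for a b
    using that K[OF that] by (auto simp: F_def countable_finite)
  obtain S where S: "C \<subseteq> S" "S \<subseteq> carrier G" "countable S" "\<And>a b. a \<in> S \<Longrightarrow> b \<in> S \<Longrightarrow> F a b \<subseteq> S"
    by (rule countable_closure[where F = F, OF C F]) auto
  have sub: "subgroup S G"
    using S c by (intro subgroupI) (auto simp: F_def)
  let ?S = "G\<lparr>carrier := S\<rparr>"
  have "group ?S" by (rule subgroup_imp_group[OF sub])
  moreover have "carrier ?S \<noteq> {\<one>\<^bsub>?S\<^esub>}" using c S by auto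
  moreover have "H = carrier ?S \<or> H = {\<one>\<^bsub>?S\<^esub>}" if H: "H \<lhd> ?S" for H
  proof (rule disjCI)
    assume "H \<noteq> {\<one>\<^bsub>?S\<^esub>}"
    interpret H: normal H ?S by (rule H)
    have HS: "H \<subseteq> S" using H.subset by simp
    have HG: "subgroup H G"
      using incl_subgroup[OF sub H.subgroup_axioms] .
    obtain a where a: "a \<in> H" "a \<noteq> \<one>\<^bsub>G\<^esub>"
      using \<open>H \<noteq> _\<close> subgroup.one_closed[OF HG] by auto
    have "b \<in> H" if b: "b \<in> S" for b
    proof -
      have aS: "a \<in> S" using a HS by blast
      \<comment> \<open>The conjugators belong to \<open>S\<close>, so normality of \<open>H\<close>
        within \<open>S\<close> is enough to keep these conjugates in \<open>H\<close>.\<close>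
      have "k \<otimes>\<^bsub>G\<^esub> a \<otimes>\<^bsub>G\<^esub> inv\<^bsub>G\<^esub> k \<in> H" if "k \<in> K a b" for k
      proof -
        have "k \<in> S" using S(4)[OF aS b] that a by (auto simp: F_def)
        then show ?thesis using H.inv_op_closed2[of k a] a m_inv_consistent[OF sub] by simp
      qed
      then have "generate G ((\<lambda>k. k \<otimes>\<^bsub>G\<^esub> a \<otimes>\<^bsub>G\<^esub> inv\<^bsub>G\<^esub> k) ` K a b) \<subseteq> H"
        by (intro generate_subgroup_incl[OF _ HG]) auto
      then show ?thesis using K[of a b] aS b a S(2) by blast
    qed
    then show "H = carrier ?S" using HS by auto
  qed
  ultimately have "is_simple ?S" unfolding is_simple_def by blast
  then show thesis using that S sub by blast
qed

section \<open>Invariance of both properties under isomorphism\<close>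

lemma is_simple_iso:
  assumes h: "h \<in> iso G H" and G: "is_simple G" and H: "group H"
  shows "is_simple H"
proof -
  have gG: "group G" using G by (simp add: is_simple_def)
  interpret group_hom G H h using h gG H by (intro group_hom.intro) (auto simp: group_hom_axioms_def iso_def)
  have b: "bij_betw h (carrier G) (carrier H)" using h by (simp add: iso_def)
  then have inj: "inj_on h (carrier G)" and surj: "h ` carrier G = carrier H"
    by (auto simp: bij_betw_def)
  have "carrier H \<noteq> {\<one>\<^bsub>H\<^esub>}"
  proof
    assume "carrier H = {\<one>\<^bsub>H\<^esub>}"
    then have "x = \<one>\<^bsub>G\<^esub>" if "x \<in> carrier G" for x
      using that inj hom_one surj by (metis G.one_closed imageI inj_onD singletonD)
    then show False using G G.one_closed unfolding is_simple_def by blast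
  qed
  moreover have "N = carrier H \<or> N = {\<one>\<^bsub>H\<^esub>}" if N: "N \<lhd> H" for N
  proof -
    interpret N: normal N H by (rule N)
    define M where "M = {x \<in> carrier G. h x \<in> N}"
    have "M \<lhd> G"
      unfolding G.normal_inv_iff
    proof (intro conjI ballI)
      show "subgroup M G" by (intro G.subgroupI) (auto simp: M_def)
      show "x \<otimes>\<^bsub>G\<^esub> m \<otimes>\<^bsub>G\<^esub> inv\<^bsub>G\<^esub> x \<in> M" if "x \<in> carrier G" "m \<in> M" for x m
        using that N.inv_op_closed2 by (simp add: M_def)
    qed
    then have "M = carrier G \<or> M = {\<one>\<^bsub>G\<^esub>}" using G by (simp add: is_simple_def)
    moreover have "N = h ` M" using N.subset surj by (auto simp: M_def)
    ultimately show ?thesis using surj by auto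
  qed
  ultimately show ?thesis using H unfolding is_simple_def by blast
qed

lemma no_nontrivial_C1_action_iso:
  assumes h: "h \<in> iso G H" and G: "no_nontrivial_C1_action G"
  shows "no_nontrivial_C1_action H"
  unfolding no_nontrivial_C1_action_def
proof (intro ballI)
  fix \<phi> y assume "\<phi> \<in> hom H Diff1_plus_I" "y \<in> carrier H"
  moreover have "h \<in> hom G H" "h ` carrier G = carrier H"
    using h by (auto simp: iso_def bij_betw_def)
  ultimately obtain x where "x \<in> carrier G" "y = h x" "\<phi> \<circ> h \<in> hom G Diff1_plus_I"
    using hom_compose[of h G H \<phi> Diff1_plus_I] by blast
  then show "\<phi> y = \<one>\<^bsub>Diff1_plus_I\<^esub>"
    using G unfolding no_nontrivial_C1_action_def by fastforce
qed

section \<open>Stability of \<open>C\<^sup>1\<close> actions\<close>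

text \<open>To first order, displacement is additive along words.\<close>

lemma displacement_word:
  fixes F :: "(real \<Rightarrow> real) set" and x p M \<epsilon> \<delta> :: real
  assumes eps: "0 \<le> \<epsilon>" "\<epsilon> \<le> 1" and x: "p \<le> x"
    and lip: "\<And>f u v. f \<in> F \<Longrightarrow> u \<in> {p..p+\<delta>} \<Longrightarrow> v \<in> {p..p+\<delta>} \<Longrightarrow> \<bar>(f u - u) - (f v - v)\<bar> \<le> \<epsilon> * \<bar>u - v\<bar>"
    and fixp: "\<And>f. f \<in> F \<Longrightarrow> f p = p"
    and mono: "\<And>f u. f \<in> F \<Longrightarrow> u \<in> {p..p+\<delta>} \<Longrightarrow> p \<le> f u"
    and M: "\<And>f. f \<in> F \<Longrightarrow> \<bar>f x - x\<bar> \<le> M" "0 \<le> M"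
    and fs: "set fs \<subseteq> F" and small: "2 ^ length fs * (x - p) \<le> \<delta>"
  defines "y \<equiv> foldr (\<lambda>f. f) fs x"
  shows "p \<le> y \<and> y - p \<le> 2 ^ length fs * (x - p) \<and> \<bar>y - x\<bar> \<le> (2 ^ length fs - 1) * M
    \<and> \<bar>y - x - (\<Sum>f\<leftarrow>fs. f x - x)\<bar> \<le> \<epsilon> * (2 ^ length fs) * M"
  using fs small unfolding y_def
proof (induction fs)
  case Nil
  then show ?case using x eps M by simp
next
  case (Cons f fs)
  define z where "z = foldr (\<lambda>f. f) fs x"
  define n where "n = (2::real) ^ length fs"
  have n: "1 \<le> n" unfolding n_def by simp
  have small: "2 * n * (x - p) \<le> \<delta>" using Cons.prems by (simp add: n_def)
  have d0: "0 \<le> x - p" using x by simp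
  have "n * (x - p) \<le> 2 * n * (x - p)" using n d0 by (simp add: mult_right_mono)
  then have small': "n * (x - p) \<le> \<delta>" using small by linarith
  then have IH: "p \<le> z" "z - p \<le> n * (x - p)" "\<bar>z - x\<bar> \<le> (n - 1) * M"
      "\<bar>z - x - (\<Sum>f\<leftarrow>fs. f x - x)\<bar> \<le> \<epsilon> * n * M"
    using Cons by (auto simp: z_def n_def)
  have f: "f \<in> F" using Cons.prems by simp
  have "1 * (x - p) \<le> n * (x - p)" using n d0 by (intro mult_right_mono) auto
  then have xD: "x \<in> {p..p+\<delta>}" using small' x by auto
  have pD: "p \<in> {p..p+\<delta>}" using xD by auto
  have zD: "z \<in> {p..p+\<delta>}" using IH small' by auto
  \<comment> \<open>The displacement of \<open>f\<close> vanishes at \<open>p\<close> and is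
    1-Lipschitz, so each letter at most doubles the distance from \<open>p\<close>. This keeps the
    whole trajectory where the Lipschitz bound applies.\<close>
  have "\<bar>(f z - z) - (f p - p)\<bar> \<le> \<epsilon> * \<bar>z - p\<bar>" by (rule lip[OF f zD pD])
  also have "\<dots> \<le> 1 * \<bar>z - p\<bar>" using eps by (intro mult_right_mono) auto
  finally have "f z - p \<le> 2 * (z - p)" using fixp[OF f] IH(1) by auto
  then have 1: "f z - p \<le> 2 * n * (x - p)" using IH(2) by auto
  \<comment> \<open>The new letter acts at \<open>z\<close> instead of \<open>x\<close>; the
    Lipschitz bound makes its displacements at the two points nearly equal.\<close>
  have e: "\<bar>(f z - z) - (f x - x)\<bar> \<le> \<epsilon> * \<bar>z - x\<bar>" by (rule lip[OF f zD xD])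
  also have "\<dots> \<le> \<epsilon> * ((n - 1) * M)" using eps IH(3) by (intro mult_left_mono) auto
  also have "\<dots> \<le> \<epsilon> * (n * M)" using eps M(2) by (intro mult_left_mono mult_right_mono) auto
  finally have 2: "\<bar>(f z - z) - (f x - x)\<bar> \<le> \<epsilon> * n * M" by simp
  have "\<epsilon> * \<bar>z - x\<bar> \<le> 1 * \<bar>z - x\<bar>" using eps by (intro mult_right_mono) auto
  with e have "\<bar>(f z - z) - (f x - x)\<bar> \<le> \<bar>z - x\<bar>" by simp
  then have "\<bar>f z - x\<bar> \<le> 2 * \<bar>z - x\<bar> + \<bar>f x - x\<bar>" by (smt (verit))
  also have "\<dots> \<le> 2 * ((n - 1) * M) + M" by (intro add_mono mult_left_mono IH M(1)[OF f]) simp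
  finally have "\<bar>f z - x\<bar> \<le> 2 * ((n - 1) * M) + M" .
  then have 3: "\<bar>f z - x\<bar> \<le> (2 * n - 1) * M" by (simp add: algebra_simps)
  have "\<bar>f z - x - ((f x - x) + (\<Sum>f\<leftarrow>fs. f x - x))\<bar> \<le> 2 * (\<epsilon> * n * M)"
    using 2 IH(4) by linarith
  then show ?case using 1 3 mono[OF f zD] by (simp add: z_def n_def algebra_simps)
qed

text \<open>The displacement has derivative \<open>f' - 1\<close>, which vanishes at
  \<open>p\<close> and by continuity stays below \<epsilon> nearby; the mean value inequality gives
  the bound. A right neighbourhood is taken because the common fixed point will be left to the
  right.\<close>

lemma C1_displacement_lipschitz:
  assumes f: "\<And>x. x \<in> I01 \<Longrightarrow> (f has_real_derivative f' x) (at x within I01)" "continuous_on I01 f'"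
    and p: "0 \<le> p" "p < 1" "f' p = 1" and "0 < \<epsilon>"
  obtains \<delta> where "0 < \<delta>" "p + \<delta> \<le> 1"
    "\<And>u v. u \<in> {p..p+\<delta>} \<Longrightarrow> v \<in> {p..p+\<delta>} \<Longrightarrow> \<bar>(f u - u) - (f v - v)\<bar> \<le> \<epsilon> * \<bar>u - v\<bar>"
proof -
  obtain d where d: "d > 0" "\<And>x. x \<in> I01 \<Longrightarrow> dist x p < d \<Longrightarrow> dist (f' x) (f' p) < \<epsilon>"
    using f(2) p \<open>0 < \<epsilon>\<close> unfolding continuous_on_iff by (metis atLeastAtMost_iff less_eq_real_def)
  define \<delta> where "\<delta> = min (d / 2) (1 - p)"
  have \<delta>: "0 < \<delta>" "\<delta> < d" "p + \<delta> \<le> 1" using d(1) p by (auto simp: \<delta>_def min_def)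
  have sub: "{p..p+\<delta>} \<subseteq> I01" using p \<delta> by auto
  have "norm ((f u - u) - (f v - v)) \<le> \<epsilon> * norm (u - v)" if "u \<in> {p..p+\<delta>}" "v \<in> {p..p+\<delta>}" for u v
  proof (rule field_differentiable_bound[OF _ _ _ that])
    show "((\<lambda>u. f u - u) has_real_derivative f' x - 1) (at x within {p..p+\<delta>})" if "x \<in> {p..p+\<delta>}" for x
      using that sub by (intro derivative_intros DERIV_subset[OF f(1)]) auto
    show "norm (f' x - 1) \<le> \<epsilon>" if "x \<in> {p..p+\<delta>}" for x
      using d(2)[of x] that sub \<delta> p by (auto simp: dist_real_def)
  qed simp
  then show thesis using that[OF \<delta>(1,3)] by simp
qed

section \<open>Interval diffeomorphisms and words in them near a fixed point\<close>

lemma homeo_plus_I_less: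
  assumes "f \<in> homeo_plus_I" "x \<in> I01" "y \<in> I01"
  shows "f x < f y \<longleftrightarrow> x < y"
  using assms by (intro strict_mono_on_less) (auto simp: homeo_plus_I_def)

lemma homeo_plus_I_image:
  assumes "f \<in> homeo_plus_I" shows "f ` I01 = I01"
  using assms homeo_plus_I_subset_Bij by (auto simp: Bij_def bij_betw_def)

lemma homeo_plus_I_range: "f \<in> homeo_plus_I \<Longrightarrow> x \<in> I01 \<Longrightarrow> f x \<in> I01"
  using homeo_plus_I_image by blast

lemma homeo_plus_I_0:
  assumes "f \<in> homeo_plus_I" shows "f 0 = 0"
proof -
  have "0 \<in> f ` I01" using homeo_plus_I_image[OF assms] by simp
  then obtain x where x: "x \<in> I01" "f x = 0" by (metis imageE)
  show ?thesis
    using homeo_plus_I_less[OF assms, of 0 x] homeo_plus_I_range[OF assms, of 0] x by (cases "x = 0") auto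
qed

text \<open>At a fixed point the derivative is nonnegative by monotonicity, and nonzero because the
  chain rule with the differentiable inverse makes it a factor of 1.\<close>

lemma diff1_derivative:
  assumes "f \<in> diff1_plus_I"
  obtains f' where "\<And>x. x \<in> I01 \<Longrightarrow> (f has_real_derivative f' x) (at x within I01)"
    "continuous_on I01 f'" "\<And>x. x \<in> I01 \<Longrightarrow> f x = x \<Longrightarrow> 0 < f' x"
proof -
  have h: "f \<in> homeo_plus_I" using assms by (simp add: diff1_plus_I_def)
  obtain f' g' where f': "\<And>x. x \<in> I01 \<Longrightarrow> (f has_real_derivative f' x) (at x within I01)" "continuous_on I01 f'"
    and g': "\<And>x. x \<in> I01 \<Longrightarrow> (inv_into I01 f has_real_derivative g' x) (at x within I01)"
    using assms unfolding diff1_plus_I_def C1_on_I_def by blast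
  have inj: "inj_on f I01" using h homeo_plus_I_subset_Bij by (auto simp: Bij_def bij_betw_def)
  have "0 < f' x" if x: "x \<in> I01" "f x = x" for x
  proof -
    have nt: "at x within I01 \<noteq> bot"
      using x by (simp add: trivial_limit_within islimpt_Icc)
    have "((\<lambda>y. (f y - f x) / (y - x)) \<longlongrightarrow> f' x) (at x within I01)"
      using f'(1)[OF x(1)] by (simp add: has_field_derivative_iff)
    moreover have "\<forall>\<^sub>F y in at x within I01. 0 \<le> (f y - f x) / (y - x)"
      unfolding eventually_at_filter
      using homeo_plus_I_less[OF h] x
      by (intro always_eventually) (smt (verit) divide_nonneg_pos divide_nonpos_neg)
    ultimately have "0 \<le> f' x" using nt tendsto_lowerbound by blast
    moreover have "f' x \<noteq> 0"
    proof
      assume "f' x = 0"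
      have "((inv_into I01 f \<circ> f) has_real_derivative g' (f x) * f' x) (at x within I01)"
        using f'(1)[OF x(1)] g'[of "f x"] x homeo_plus_I_image[OF h]
        by (intro DERIV_image_chain) auto
      moreover have "((inv_into I01 f \<circ> f) has_real_derivative 1) (at x within I01)"
        using DERIV_cong_within_I01[of "inv_into I01 f \<circ> f" "\<lambda>x. x" x 1] inj x by simp
      ultimately have "g' (f x) * f' x = 1"
        using has_field_derivative_unique nt by blast
      then show False using \<open>f' x = 0\<close> by simp
    qed
    ultimately show ?thesis by simp
  qed
  with f' show thesis by (rule that)
qed

text \<open>By the chain rule the derivative at a common fixed point is multiplicative on words. The
  image condition is carried along because derivatives are taken within the interval.\<close>

lemma DERIV_word_at_fixed_point:
  fixes d :: "(real \<Rightarrow> real) \<Rightarrow> real"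
  assumes "p \<in> I01"
    and "\<And>f. f \<in> set fs \<Longrightarrow> f p = p \<and> f ` I01 \<subseteq> I01 \<and> (f has_real_derivative d f) (at p within I01)"
  shows "foldr (\<lambda>f. f) fs p = p \<and> foldr (\<lambda>f. f) fs ` I01 \<subseteq> I01 \<and>
    (foldr (\<lambda>f. f) fs has_real_derivative (\<Prod>f\<leftarrow>fs. d f)) (at p within I01)"
  using assms(2)
proof (induction fs)
  case Nil
  then show ?case by (simp add: id_def)
next
  case (Cons f fs)
  let ?w = "foldr (\<lambda>f. f) fs"
  have w: "?w p = p" "?w ` I01 \<subseteq> I01" "(?w has_real_derivative (\<Prod>f\<leftarrow>fs. d f)) (at p within I01)"
    using Cons by auto
  have f: "f p = p" "f ` I01 \<subseteq> I01" "(f has_real_derivative d f) (at p within I01)"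
    using Cons.prems by auto
  have "(f has_real_derivative d f) (at (?w p) within ?w ` I01)"
    unfolding w(1) by (rule DERIV_subset[OF f(3) w(2)])
  then have "(f \<circ> ?w has_real_derivative d f * (\<Prod>f\<leftarrow>fs. d f)) (at p within I01)"
    using w(3) by (rule DERIV_image_chain)
  then show ?case using w f by (auto simp: o_def)
qed

text \<open>The multiplicative form of the linear system with determinant -1: the relations give
  \<open>\<beta> ^ 5 = \<alpha> ^ 7\<close>, so \<open>\<beta> ^ 15\<close> equals both
  \<open>\<alpha> ^ 20\<close> and \<open>\<alpha> ^ 21\<close>.\<close>

lemma eq_one_if_triangle_relations:
  fixes \<alpha> \<beta> :: real
  assumes "0 < \<alpha>" "0 < \<beta>" "\<alpha> ^ 4 = \<beta> ^ 3" "(\<beta> * \<alpha>) ^ 5 = \<alpha> ^ 12"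
  shows "\<alpha> = 1" "\<beta> = 1"
proof -
  have "\<alpha> ^ 5 * \<beta> ^ 5 = \<alpha> ^ 5 * \<alpha> ^ 7"
    using assms(4) by (simp add: power_mult_distrib mult.commute flip: power_add)
  then have b5: "\<beta> ^ 5 = \<alpha> ^ 7"
    by (rule mult_left_cancel[THEN iffD1, rotated]) (use assms(1) in simp)
  have "\<alpha> ^ 20 * 1 = (\<alpha> ^ 4) ^ 5" by (simp flip: power_mult)
  also have "\<dots> = (\<beta> ^ 5) ^ 3" unfolding assms(3) by (simp flip: power_mult)
  also have "\<dots> = \<alpha> ^ 20 * \<alpha>" unfolding b5 by (simp flip: power_mult power_Suc2)
  finally show a: "\<alpha> = 1" using assms(1) by simp
  then have "\<beta> ^ 3 = 1" using assms(3) by simp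
  then show "\<beta> = 1" using assms(2) power_eq_imp_eq_base[of \<beta> 3 1] by simp
qed

text \<open>The argument of the Thurston stability theorem: to first order at a boundary point of the common
  fixed point set, displacement is additive on words, and the two relations force it to vanish.\<close>

lemma C1_stability:
  assumes A: "A \<in> diff1_plus_I" and B: "B \<in> diff1_plus_I"
    and rel: "\<And>x. x \<in> I01 \<Longrightarrow> (A ^^ 4) x = (B ^^ 3) x" "\<And>x. x \<in> I01 \<Longrightarrow> ((B \<circ> A) ^^ 5) x = (A ^^ 12) x"
    and z: "z \<in> I01"
  shows "A z = z"
proof (rule ccontr)
  assume nz: "A z \<noteq> z"
  let ?W = "foldr (\<lambda>f. f) :: (real \<Rightarrow> real) list \<Rightarrow> real \<Rightarrow> real"
  \<comment> \<open>The two sides of the two relations, spelled as words; the leftmost letter is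
    applied last.\<close>
  define w1 where "w1 = [A, A, A, A]"
  define w2 where "w2 = [B, B, B]"
  define w3 where "w3 = [B, A, B, A, B, A, B, A, B, A]"
  define w4 where "w4 = [A, A, A, A, A, A, A, A, A, A, A, A]"
  note ws = w1_def w2_def w3_def w4_def
  have rel': "?W w1 x = ?W w2 x" "?W w3 x = ?W w4 x" if "x \<in> I01" for x
    using rel[OF that] by (simp_all add: ws numeral_eq_Suc)
  have sets: "set w1 \<subseteq> {A, B}" "set w2 \<subseteq> {A, B}" "set w3 \<subseteq> {A, B}" "set w4 \<subseteq> {A, B}"
    by (auto simp: ws)
  have hAB: "f \<in> homeo_plus_I" if "f \<in> {A, B}" for f using A B that by (auto simp: diff1_plus_I_def)
  obtain A' where A': "\<And>x. x \<in> I01 \<Longrightarrow> (A has_real_derivative A' x) (at x within I01)"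
    "continuous_on I01 A'" "\<And>x. x \<in> I01 \<Longrightarrow> A x = x \<Longrightarrow> 0 < A' x"
    using diff1_derivative[OF A] by metis
  obtain B' where B': "\<And>x. x \<in> I01 \<Longrightarrow> (B has_real_derivative B' x) (at x within I01)"
    "continuous_on I01 B'" "\<And>x. x \<in> I01 \<Longrightarrow> B x = x \<Longrightarrow> 0 < B' x"
    using diff1_derivative[OF B] by metis
  \<comment> \<open>\<open>K\<close> is the set of common fixed points up to \<open>z\<close>. It is
    compact and contains 0, so it has a last point \<open>p\<close>, and \<open>p < z\<close>
    because \<open>A\<close> moves \<open>z\<close>.\<close>
  define K where "K = {x \<in> {0..z}. A x - x = 0 \<and> B x - x = 0}"
  have sub: "{0..z} \<subseteq> I01" using z by auto
  have "continuous_on {0..z} (\<lambda>x. A x - x)" "continuous_on {0..z} (\<lambda>x. B x - x)"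
    using DERIV_continuous_on[of I01 A A'] DERIV_continuous_on[of I01 B B'] A'(1) B'(1)
    by (auto intro!: continuous_intros intro: continuous_on_subset[OF _ sub])
  then have "closed ({x \<in> {0..z}. A x - x = 0} \<inter> {x \<in> {0..z}. B x - x = 0})"
    by (intro closed_Int continuous_closed_preimage_constant) auto
  then have clK: "closed K" by (rule back_subst[of closed]) (auto simp: K_def)
  have K0: "0 \<in> K" using z homeo_plus_I_0[OF hAB] by (auto simp: K_def)
  have bdd: "bdd_above K" by (auto simp: K_def bdd_above_def)
  define p where "p = Sup K"
  have pK: "p \<in> K" unfolding p_def using closed_contains_Sup[OF _ bdd clK] K0 by auto
  have p: "0 \<le> p" "p \<le> z" "A p = p" "B p = p" using pK by (auto simp: K_def)
  have pz: "p < z" using p nz by (cases "p = z") auto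
  have pI: "p \<in> I01" "p < 1" using p z pz by auto
  have notfix: "A x \<noteq> x \<or> B x \<noteq> x" if "p < x" "x \<le> z" for x
    using cSup_upper[OF _ bdd, of x] that p by (auto simp: K_def p_def)
  \<comment> \<open>One function of the letter, so that products along words make sense; uniqueness
    of the derivative determines its values at \<open>A\<close> and \<open>B\<close>.\<close>
  define d where "d f = (SOME D. (f has_real_derivative D) (at p within I01))" for f
  have nt: "at p within I01 \<noteq> bot" using pI by (simp add: trivial_limit_within islimpt_Icc)
  have d: "d f = D" if "(f has_real_derivative D) (at p within I01)" for f D
    unfolding d_def using that nt by (intro some_equality) (auto intro: has_field_derivative_unique)
  have dAB: "d A = A' p" "d B = B' p" using d A'(1) B'(1) pI by auto
  have D: "(?W w has_real_derivative (\<Prod>f\<leftarrow>w. d f)) (at p within I01)" if "set w \<subseteq> {A, B}" for w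
  proof -
    have "f p = p \<and> f ` I01 \<subseteq> I01 \<and> (f has_real_derivative d f) (at p within I01)" if "f \<in> {A, B}" for f
      using that homeo_plus_I_image[OF hAB[OF that]] p A'(1)[OF pI(1)] B'(1)[OF pI(1)] dAB by auto
    then show ?thesis using DERIV_word_at_fixed_point[OF pI(1), of w d] that by blast
  qed
  have deq: "(\<Prod>f\<leftarrow>w. d f) = (\<Prod>f\<leftarrow>w'. d f)"
    if "set w \<subseteq> {A, B}" "set w' \<subseteq> {A, B}" "\<And>x. x \<in> I01 \<Longrightarrow> ?W w x = ?W w' x" for w w'
  proof (rule has_field_derivative_unique[OF D[OF that(1)] _ nt])
    show "(?W w has_real_derivative (\<Prod>f\<leftarrow>w'. d f)) (at p within I01)"
      using D[OF that(2)] DERIV_cong_within_I01[of "?W w" "?W w'" p] that(3) pI(1) by blast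
  qed
  have "A' p ^ 4 = B' p ^ 3"
    using deq[OF sets(1,2) rel'(1)] by (simp add: ws dAB numeral_eq_Suc)
  moreover have "(B' p * A' p) ^ 5 = A' p ^ 12"
    using deq[OF sets(3,4) rel'(2)] by (simp add: ws dAB numeral_eq_Suc mult.assoc)
  ultimately have one: "A' p = 1" "B' p = 1"
    using eq_one_if_triangle_relations[of "A' p" "B' p"] A'(3)[OF pI(1)] B'(3)[OF pI(1)] p by auto
  \<comment> \<open>The longest word has 12 letters, so the error is at most
    \<open>\<epsilon> * 2 ^ 12 * M\<close>, which is below \<open>M / 200\<close>.\<close>
  define \<epsilon> :: real where "\<epsilon> = 1 / 10 ^ 6"
  have eps: "0 < \<epsilon>" "\<epsilon> \<le> 1" by (auto simp: \<epsilon>_def)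
  obtain \<delta>1 where \<delta>1: "0 < \<delta>1" "p + \<delta>1 \<le> 1"
    "\<And>u v. u \<in> {p..p+\<delta>1} \<Longrightarrow> v \<in> {p..p+\<delta>1} \<Longrightarrow> \<bar>(A u - u) - (A v - v)\<bar> \<le> \<epsilon> * \<bar>u - v\<bar>"
    using C1_displacement_lipschitz[OF A'(1,2) p(1) pI(2) one(1) eps(1)] by metis
  obtain \<delta>2 where \<delta>2: "0 < \<delta>2" "p + \<delta>2 \<le> 1"
    "\<And>u v. u \<in> {p..p+\<delta>2} \<Longrightarrow> v \<in> {p..p+\<delta>2} \<Longrightarrow> \<bar>(B u - u) - (B v - v)\<bar> \<le> \<epsilon> * \<bar>u - v\<bar>"
    using C1_displacement_lipschitz[OF B'(1,2) p(1) pI(2) one(2) eps(1)] by metis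
  define \<delta> where "\<delta> = min (min \<delta>1 \<delta>2) (z - p)"
  have \<delta>: "0 < \<delta>" "\<delta> \<le> \<delta>1" "\<delta> \<le> \<delta>2" "\<delta> \<le> z - p" using \<delta>1 \<delta>2 pz by (auto simp: \<delta>_def)
  \<comment> \<open>So close to \<open>p\<close> that 12 doublings of the distance do not exceed
    \<delta>. As \<open>x\<close> lies beyond the last common fixed point, \<open>M\<close> is
    positive.\<close>
  define x where "x = p + \<delta> / 2 ^ 12"
  have x: "p < x" "x \<le> z" "x \<in> I01" using \<delta> pI z by (auto simp: x_def field_simps)
  define M where "M = max \<bar>A x - x\<bar> \<bar>B x - x\<bar>"
  have M: "0 < M" using notfix[OF x(1,2)] by (auto simp: M_def)
  have word: "\<bar>?W w x - x - (\<Sum>f\<leftarrow>w. f x - x)\<bar> \<le> \<epsilon> * 2 ^ 12 * M"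
    if w: "set w \<subseteq> {A, B}" "length w \<le> 12" for w
  proof -
    have n: "(2::real) ^ length w \<le> 2 ^ 12" using w(2) by (intro power_increasing) auto
    have "2 ^ length w * (x - p) \<le> 2 ^ 12 * (x - p)" using n x by (intro mult_right_mono) auto
    also have "\<dots> = \<delta>" by (simp add: x_def)
    finally have small: "2 ^ length w * (x - p) \<le> \<delta>" .
    have "\<bar>?W w x - x - (\<Sum>f\<leftarrow>w. f x - x)\<bar> \<le> \<epsilon> * 2 ^ length w * M"
    proof (rule displacement_word[where F = "{A, B}" and p = p and \<delta> = \<delta>, THEN conjunct2, THEN conjunct2, THEN conjunct2])
      show "\<bar>(f u - u) - (f v - v)\<bar> \<le> \<epsilon> * \<bar>u - v\<bar>"
        if "f \<in> {A, B}" "u \<in> {p..p+\<delta>}" "v \<in> {p..p+\<delta>}" for f u v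
        using that \<delta>1(3)[of u v] \<delta>2(3)[of u v] \<delta> by auto
      show "p \<le> f u" if f: "f \<in> {A, B}" and u: "u \<in> {p..p+\<delta>}" for f u
      proof -
        have "u \<in> I01" using u \<delta> \<delta>1(2) pI by auto
        then have "\<not> f u < f p" using homeo_plus_I_less[OF hAB[OF f]] pI u by auto
        then show ?thesis using f p by auto
      qed
    qed (use eps x p M w small in \<open>auto simp: M_def\<close>)
    also have "\<dots> \<le> \<epsilon> * 2 ^ 12 * M" using n eps M by (intro mult_right_mono mult_left_mono) auto
    finally show ?thesis .
  qed
  have bd: "\<epsilon> * 2 ^ 12 * M \<le> M / 200" using M by (simp add: \<epsilon>_def)
  define a b where "a = A x - x" and "b = B x - x"
  have "\<bar>?W w1 x - x - 4 * a\<bar> \<le> M / 200" "\<bar>?W w2 x - x - 3 * b\<bar> \<le> M / 200"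
    "\<bar>?W w3 x - x - (5 * a + 5 * b)\<bar> \<le> M / 200" "\<bar>?W w4 x - x - 12 * a\<bar> \<le> M / 200"
    using word[OF sets(1)] word[OF sets(2)] word[OF sets(3)] word[OF sets(4)] bd
    by (simp_all add: ws a_def b_def algebra_simps)
  \<comment> \<open>The two words of each relation agree at \<open>x\<close>, so their linear parts
    differ by at most two errors.\<close>
  then have 1: "\<bar>4 * a - 3 * b\<bar> \<le> M / 100" "\<bar>5 * b - 7 * a\<bar> \<le> M / 100"
    using rel'[OF x(3)] by linarith+
  \<comment> \<open>With \<open>u = 4 * a - 3 * b\<close> and \<open>v = 5 * b - 7 * a\<close> one
    has \<open>5 * u + 3 * v = - a\<close> and \<open>7 * u + 4 * v = - b\<close>. Both
    displacements are thus far below \<open>M\<close>, their maximum in absolute value.\<close>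
  have "\<bar>a\<bar> < M" using 1 M by linarith
  moreover have "\<bar>b\<bar> < M" using 1 M by linarith
  ultimately show False by (auto simp: M_def a_def b_def)
qed

section \<open>From the triangle relations to triviality of actions\<close>

lemma Diff1_plus_I_mult:
  assumes "f \<in> diff1_plus_I" "g \<in> diff1_plus_I" "x \<in> I01"
  shows "(f \<otimes>\<^bsub>Diff1_plus_I\<^esub> g) x = f (g x)"
proof -
  have "f \<in> Bij I01" "g \<in> Bij I01" using assms homeo_plus_I_subset_Bij by (auto simp: diff1_plus_I_def)
  then show ?thesis using assms(3) by (simp add: Diff1_plus_I_def BijGroup_def compose_eq)
qed

lemma Diff1_plus_I_pow:
  assumes "f \<in> diff1_plus_I" "x \<in> I01"
  shows "(f [^]\<^bsub>Diff1_plus_I\<^esub> (n::nat)) x = (f ^^ n) x"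
  using assms(2)
proof (induction n arbitrary: x)
  case 0
  then show ?case by (simp add: Diff1_plus_I_def BijGroup_def)
next
  case (Suc n)
  interpret group Diff1_plus_I by (rule group_Diff1_plus_I)
  have c: "carrier Diff1_plus_I = diff1_plus_I" by (simp add: Diff1_plus_I_def)
  have "f x \<in> I01" using assms(1) Suc.prems homeo_plus_I_range by (auto simp: diff1_plus_I_def)
  then show ?case
    using Suc assms(1) nat_pow_closed[of f n] by (simp add: Diff1_plus_I_mult c funpow_Suc_right del: funpow.simps)
qed

text \<open>The images of \<open>a\<close> and \<open>b\<close> satisfy the same relations, so
  stability puts \<open>a\<close> in the kernel; a normal subgroup with a nontrivial element is the
  whole group.\<close>

lemma no_nontrivial_C1_action_if_triangle_relations:
  assumes G: "is_simple G" and ab: "a \<in> carrier G" "b \<in> carrier G" "a \<noteq> \<one>\<^bsub>G\<^esub>"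
    and rel: "a [^]\<^bsub>G\<^esub> (4::nat) = b [^]\<^bsub>G\<^esub> (3::nat)"
      "(b \<otimes>\<^bsub>G\<^esub> a) [^]\<^bsub>G\<^esub> (5::nat) = a [^]\<^bsub>G\<^esub> (12::nat)"
  shows "no_nontrivial_C1_action G"
  unfolding no_nontrivial_C1_action_def
proof (intro ballI)
  fix \<phi> y assume \<phi>: "\<phi> \<in> hom G Diff1_plus_I" and y: "y \<in> carrier G"
  interpret group_hom G Diff1_plus_I \<phi>
    using G \<phi> group_Diff1_plus_I by (simp add: group_hom_def group_hom_axioms_def is_simple_def)
  have c: "carrier Diff1_plus_I = diff1_plus_I" by (simp add: Diff1_plus_I_def)
  have A: "\<phi> a \<in> diff1_plus_I" and B: "\<phi> b \<in> diff1_plus_I" using ab c hom_closed by auto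
  have C: "\<phi> (b \<otimes>\<^bsub>G\<^esub> a) \<in> diff1_plus_I" using ab c hom_closed by auto
  have "(\<phi> a ^^ 4) x = (\<phi> b ^^ 3) x" if "x \<in> I01" for x
    using arg_cong[OF rel(1), of \<phi>] ab Diff1_plus_I_pow[OF A that, of 4] Diff1_plus_I_pow[OF B that, of 3]
    by (simp add: hom_nat_pow)
  moreover have "((\<phi> b \<circ> \<phi> a) ^^ 5) x = (\<phi> a ^^ 12) x" if x: "x \<in> I01" for x
  proof -
    have "(\<phi> (b \<otimes>\<^bsub>G\<^esub> a) ^^ n) x = ((\<phi> b \<circ> \<phi> a) ^^ n) x" for n
      using x
    proof (induction n arbitrary: x)
      case (Suc n)
      have "\<phi> b (\<phi> a x) \<in> I01"
        using Suc.prems A B homeo_plus_I_range by (auto simp: diff1_plus_I_def)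
      with Suc show ?case
        using ab A B by (simp add: Diff1_plus_I_mult funpow_Suc_right del: funpow.simps)
    qed simp
    then show ?thesis
      using arg_cong[OF rel(2), of \<phi>] ab Diff1_plus_I_pow[OF A x, of 12] Diff1_plus_I_pow[OF C x, of 5]
      by (simp add: hom_nat_pow del: hom_mult)
  qed
  ultimately have *: "\<phi> a x = x" if "x \<in> I01" for x using C1_stability[OF A B] that by blast
  \<comment> \<open>Stability speaks about points of the interval only; extensionality upgrades it
    to equality with the identity of the group.\<close>
  have "\<phi> a \<in> extensional I01" using A by (simp add: diff1_plus_I_def homeo_plus_I_def)
  then have "\<phi> a = (\<lambda>x\<in>I01. x)" using * by (intro extensionalityI[of _ I01]) auto
  then have "\<phi> a = \<one>\<^bsub>Diff1_plus_I\<^esub>" by (simp add: Diff1_plus_I_def BijGroup_def)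
  then have "a \<in> kernel G Diff1_plus_I \<phi>" using ab by (simp add: kernel_def)
  then have "kernel G Diff1_plus_I \<phi> = carrier G"
    using is_simpleD[OF G normal_kernel] ab(3) by blast
  then show "\<phi> y = \<one>\<^bsub>Diff1_plus_I\<^esub>" using y by (auto simp: kernel_def)
qed

section \<open>The generators\<close>

text \<open>A lift of an element of order 3 of Thompson's group \<open>T\<close>: it permutes cyclically the intervals
  \<open>[0, 1/2]\<close>, \<open>[1/2, 3/4]\<close>, \<open>[3/4, 1]\<close> modulo 1. Its product with the rotation by \<open>1/4\<close> has order 5 in \<open>T\<close>.\<close>

definition rot3 :: "real \<Rightarrow> real" where
  "rot3 x = (let n = of_int \<lfloor>x\<rfloor>; y = x - n in
     n + (if y < 1/2 then 1/2 + y/2 else if y < 3/4 then y + 1/4 else 2 * y - 1/2))"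

lemma rot3_eq:
  "of_int n \<le> x \<Longrightarrow> x < of_int n + 1/2 \<Longrightarrow> rot3 x = of_int n + 1/2 + (x - of_int n) / 2"
  "of_int n + 1/2 \<le> x \<Longrightarrow> x < of_int n + 3/4 \<Longrightarrow> rot3 x = x + 1/4"
  "of_int n + 3/4 \<le> x \<Longrightarrow> x < of_int n + 1 \<Longrightarrow> rot3 x = 2 * x - of_int n - 1/2"
proof -
  have n: "of_int n \<le> x \<Longrightarrow> x < of_int n + 1 \<Longrightarrow> \<lfloor>x\<rfloor> = n" by (simp add: floor_unique)
  show "of_int n \<le> x \<Longrightarrow> x < of_int n + 1/2 \<Longrightarrow> rot3 x = of_int n + 1/2 + (x - of_int n) / 2"
    using n by (simp add: rot3_def Let_def)
  show "of_int n + 1/2 \<le> x \<Longrightarrow> x < of_int n + 3/4 \<Longrightarrow> rot3 x = x + 1/4"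
    using n by (simp add: rot3_def Let_def)
  show "of_int n + 3/4 \<le> x \<Longrightarrow> x < of_int n + 1 \<Longrightarrow> rot3 x = 2 * x - of_int n - 1/2"
    using n by (simp add: rot3_def Let_def)
qed

lemma rot3_bounds: "of_int \<lfloor>x\<rfloor> + 1/2 \<le> rot3 x \<and> rot3 x < of_int \<lfloor>x\<rfloor> + 3/2"
proof -
  define n where "n = \<lfloor>x\<rfloor>"
  have n: "of_int n \<le> x" "x < of_int n + 1" unfolding n_def by linarith+
  consider "x < of_int n + 1/2" | "of_int n + 1/2 \<le> x" "x < of_int n + 3/4" | "of_int n + 3/4 \<le> x" by linarith
  then have "of_int n + 1/2 \<le> rot3 x \<and> rot3 x < of_int n + 3/2"
    using n by cases (simp_all add: rot3_eq[of n] field_simps)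
  then show ?thesis by (simp add: n_def)
qed

text \<open>Three steps pass once through each of the three pieces, whose slopes 1/2, 1, 2 multiply
  to 1, and complete one turn.\<close>

lemma rot3_pow3: "rot3 (rot3 (rot3 x)) = x + 1"
proof -
  define n where "n = \<lfloor>x\<rfloor>"
  have n: "of_int n \<le> x" "x < of_int n + 1" unfolding n_def by linarith+
  note r = rot3_eq[of n] rot3_eq[of "n + 1"]
  consider "x < of_int n + 1/2" | "of_int n + 1/2 \<le> x" "x < of_int n + 3/4" | "of_int n + 3/4 \<le> x" by linarith
  then show ?thesis using n by cases (simp_all add: r field_simps)
qed

text \<open>Modulo 1 the five intervals of the case split are permuted cyclically, and five steps
  make three turns.\<close>

lemma rot3_shift_pow5: "(rot3 \<circ> (\<lambda>x. x + 1/4)) ^^ 5 = (\<lambda>x. x + 3)"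
proof
  fix x :: real
  define n where "n = \<lfloor>x\<rfloor>"
  have n: "of_int n \<le> x" "x < of_int n + 1" unfolding n_def by linarith+
  note r = rot3_eq[of n] rot3_eq[of "n + 1"] rot3_eq[of "n + 2"] rot3_eq[of "n + 3"]
  consider "x < of_int n + 1/4" | "of_int n + 1/4 \<le> x" "x < of_int n + 1/2"
    | "of_int n + 1/2 \<le> x" "x < of_int n + 5/8" | "of_int n + 5/8 \<le> x" "x < of_int n + 3/4"
    | "of_int n + 3/4 \<le> x" by linarith
  then show "((rot3 \<circ> (\<lambda>x. x + 1/4)) ^^ 5) x = x + 3"
    using n by cases (simp_all add: numeral_eq_Suc r field_simps)
qed

lemma rot3_homeo: "rot3 \<in> homeo_R"
proof (rule homeo_R_I)
  show "rot3 x < rot3 y" if xy: "x < y" for x y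
  proof -
    have "\<lfloor>x\<rfloor> \<le> \<lfloor>y\<rfloor>" using xy by (intro floor_mono) simp
    then consider "\<lfloor>x\<rfloor> = \<lfloor>y\<rfloor>" | "of_int \<lfloor>x\<rfloor> + 1 \<le> (of_int \<lfloor>y\<rfloor> :: real)" by linarith
    then show ?thesis
    proof cases
      case 1
      then show ?thesis using xy by (auto simp: rot3_def Let_def field_simps)
    next
      case 2
      then show ?thesis using rot3_bounds[of x] rot3_bounds[of y] by linarith
    qed
  qed
  \<comment> \<open>Surjectivity follows from the cube being a translation.\<close>
  show "\<exists>x. rot3 x = y" for y using rot3_pow3[of "y - 1"] by (metis diff_add_cancel)
qed

section \<open>Pushed translations and the triangle relations\<close>

lemma push_eq_iff: "push f = push g \<longleftrightarrow> f = g"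
  using push_inj by blast

lemma push_pow_Homeo_c: "push f [^]\<^bsub>Homeo_c\<^esub> (n::nat) = push (f ^^ n)"
proof (induction n)
  case (Suc n)
  then have "push f [^]\<^bsub>Homeo_c\<^esub> Suc n = push (f ^^ n) \<circ> push f" by simp
  then show ?case by (simp only: push_comp funpow_Suc_right)
qed (use push_id in \<open>simp add: id_def\<close>)

definition tr :: "real \<Rightarrow> real \<Rightarrow> real" where "tr d = push (\<lambda>x. x + d)"

lemma tr_mem: "tr d \<in> homeo_c"
  by (simp add: tr_def push_homeo_c homeo_R_shift)

lemma tr_mult: "tr d \<circ> tr e = tr (d + e)"
  unfolding tr_def push_comp by (simp add: o_def algebra_simps)

lemma tr_pow: "tr d [^]\<^bsub>Homeo_c\<^esub> (n::nat) = tr (real n * d)"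
proof (induction n)
  case 0
  then show ?case using push_id by (simp add: tr_def id_def)
next
  case (Suc n)
  then show ?case by (simp add: tr_mult algebra_simps)
qed

lemma tr_inv: "inv\<^bsub>Homeo_c\<^esub> (tr d) = tr (- d)"
proof (rule group.inv_equality[OF group_Homeo_c])
  show "tr (- d) \<otimes>\<^bsub>Homeo_c\<^esub> tr d = \<one>\<^bsub>Homeo_c\<^esub>"
    using push_id by (simp add: tr_mult) (simp add: tr_def id_def)
qed (simp_all add: tr_mem)

lemma triangle_relations_Homeo_c:
  "tr (1/4) [^]\<^bsub>Homeo_c\<^esub> (4::nat) = push rot3 [^]\<^bsub>Homeo_c\<^esub> (3::nat)"
  "(push rot3 \<otimes>\<^bsub>Homeo_c\<^esub> tr (1/4)) [^]\<^bsub>Homeo_c\<^esub> (5::nat) = tr (1/4) [^]\<^bsub>Homeo_c\<^esub> (12::nat)"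
proof -
  have "rot3 ^^ 3 = (\<lambda>x. x + 1)" using rot3_pow3 by (auto simp: numeral_eq_Suc)
  then show "tr (1/4) [^]\<^bsub>Homeo_c\<^esub> (4::nat) = push rot3 [^]\<^bsub>Homeo_c\<^esub> (3::nat)"
    unfolding tr_pow push_pow_Homeo_c by (simp add: tr_def)
  show "(push rot3 \<otimes>\<^bsub>Homeo_c\<^esub> tr (1/4)) [^]\<^bsub>Homeo_c\<^esub> (5::nat) = tr (1/4) [^]\<^bsub>Homeo_c\<^esub> (12::nat)"
    unfolding tr_pow using rot3_shift_pow5 by (simp add: tr_def push_comp push_pow_Homeo_c)
qed

text \<open>The support is exactly the open unit interval, so \<open>bump\<close> commutes with its translate by \<open>d \<noteq> 0\<close>
  iff the two supports are disjoint.\<close>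

definition bump :: "real \<Rightarrow> real" where "bump = tr 1"

lemma bump_homeo: "bump \<in> homeo_R"
  by (simp add: bump_def tr_mem homeo_c_R)

lemma bump_inside: "0 < x \<Longrightarrow> x < 1 \<Longrightarrow> x < bump x \<and> bump x < 1"
proof -
  assume x: "0 < x" "x < 1"
  then have "squeeze (stretch x) < squeeze (stretch x + 1)" by (simp only: squeeze_less)
  then show ?thesis using x by (simp add: bump_def tr_def push_def squeeze_range squeeze_stretch)
qed

lemma bump_outside: "\<not> (0 < x \<and> x < 1) \<Longrightarrow> bump x = x"
  unfolding bump_def tr_def by (rule push_outside)

lemma bump_commutes_translate_iff:
  assumes "d \<noteq> 0"
  shows "(\<forall>x. bump (bump (x - d) + d) = bump (bump x - d) + d) \<longleftrightarrow> 1 \<le> \<bar>d\<bar>"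
proof (intro iffI allI)
  assume comm: "\<forall>x. bump (bump (x - d) + d) = bump (bump x - d) + d"
  show "1 \<le> \<bar>d\<bar>"
  proof (rule ccontr)
    assume "\<not> 1 \<le> \<bar>d\<bar>"
    then consider "0 < d" "d < 1" | "-1 < d" "d < 0" using assms by linarith
    then show False
    proof cases
      case 1
      \<comment> \<open>The translate fixes \<open>d\<close>, the left end of its support, which
        \<open>bump\<close> moves. Commutation would make it fix \<open>bump d\<close> as well, a
        point inside its support.\<close>
      have "bump d = bump (bump d - d) + d" using comm[rule_format, of d] bump_outside[of 0] by simp
      then show False using bump_inside[of d] bump_inside[of "bump d - d"] 1 by auto
    next
      case 2
      \<comment> \<open>The roles are exchanged: \<open>bump\<close> fixes 0, so it would fix the
        image of 0 under the translate, which lies in (0, 1).\<close>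
      have "bump (bump (- d) + d) = bump (- d) + d"
        using comm[rule_format, of 0] bump_outside[of 0] by simp
      then show False using bump_inside[of "- d"] bump_inside[of "bump (- d) + d"] 2 by auto
    qed
  qed
next
  fix x assume "1 \<le> \<bar>d\<bar>"
  then have disj: "\<not> (0 < y \<and> y < 1)" if "0 < y - d" "y - d < 1" for y using that by auto
  consider "0 < x" "x < 1" | "0 < x - d" "x - d < 1" | "\<not> (0 < x \<and> x < 1)" "\<not> (0 < x - d \<and> x - d < 1)" by blast
  then show "bump (bump (x - d) + d) = bump (bump x - d) + d"
  proof cases
    case 1
    then have "bump (x - d) = x - d" "bump (bump x - d) = bump x - d"
      using disj[of x] disj[of "bump x"] bump_inside[of x] by (auto intro!: bump_outside)
    then show ?thesis by simp
  next
    case 2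
    then have "bump x = x" "bump (bump (x - d) + d) = bump (x - d) + d"
      using disj[of x] disj[of "bump (x - d) + d"] bump_inside[of "x - d"] by (auto intro!: bump_outside)
    then show ?thesis by simp
  next
    case 3
    then have "bump (x - d) = x - d" "bump x = x" by (auto intro!: bump_outside)
    then show ?thesis by simp
  qed
qed

section \<open>An isomorphism invariant of marked groups\<close>

definition conj_commutes :: "('a, 'b) monoid_scheme \<Rightarrow> 'a \<Rightarrow> 'a \<Rightarrow> 'a \<Rightarrow> nat \<Rightarrow> nat \<Rightarrow> bool" where
  "conj_commutes G t s f m n \<longleftrightarrow>
     (let w = inv\<^bsub>G\<^esub> (t [^]\<^bsub>G\<^esub> n) \<otimes>\<^bsub>G\<^esub> s [^]\<^bsub>G\<^esub> m; c = w \<otimes>\<^bsub>G\<^esub> f \<otimes>\<^bsub>G\<^esub> inv\<^bsub>G\<^esub> w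
      in c \<otimes>\<^bsub>G\<^esub> f = f \<otimes>\<^bsub>G\<^esub> c)"

text \<open>Injectivity gives both directions. This applies to isomorphisms between subgroups and
  also to inclusions, so the property may be evaluated in the ambient group.\<close>

lemma conj_commutes_hom:
  assumes "group G" "group H" and h: "h \<in> hom G H" "inj_on h (carrier G)"
    and c: "t \<in> carrier G" "s \<in> carrier G" "f \<in> carrier G"
  shows "conj_commutes H (h t) (h s) (h f) m n = conj_commutes G t s f m n"
proof -
  interpret group_hom G H h using assms by (simp add: group_hom_def group_hom_axioms_def)
  define w where "w = inv\<^bsub>G\<^esub> (t [^]\<^bsub>G\<^esub> n) \<otimes>\<^bsub>G\<^esub> s [^]\<^bsub>G\<^esub> m"
  define k where "k = w \<otimes>\<^bsub>G\<^esub> f \<otimes>\<^bsub>G\<^esub> inv\<^bsub>G\<^esub> w"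
  have w: "w \<in> carrier G" "h w = inv\<^bsub>H\<^esub> (h t [^]\<^bsub>H\<^esub> n) \<otimes>\<^bsub>H\<^esub> h s [^]\<^bsub>H\<^esub> m"
    using c by (simp_all add: w_def hom_nat_pow)
  have k: "k \<in> carrier G" "h k = h w \<otimes>\<^bsub>H\<^esub> h f \<otimes>\<^bsub>H\<^esub> inv\<^bsub>H\<^esub> (h w)"
    using c w(1) by (simp_all add: k_def)
  have "h k \<otimes>\<^bsub>H\<^esub> h f = h f \<otimes>\<^bsub>H\<^esub> h k \<longleftrightarrow> h (k \<otimes>\<^bsub>G\<^esub> f) = h (f \<otimes>\<^bsub>G\<^esub> k)"
    using c k(1) by simp
  also have "\<dots> \<longleftrightarrow> k \<otimes>\<^bsub>G\<^esub> f = f \<otimes>\<^bsub>G\<^esub> k"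
    by (rule inj_on_eq_iff[OF h(2)]) (use c k(1) in simp_all)
  finally show ?thesis unfolding conj_commutes_def Let_def w_def[symmetric] k_def[symmetric] w(2)[symmetric] k(2)[symmetric] .
qed

text \<open>The conjugating word is the translation by \<open>real m * \<alpha> - real n\<close>.
  The value 0 is excluded because \<open>bump\<close> commutes with itself.\<close>

lemma conj_commutes_bump:
  assumes "real m * \<alpha> \<noteq> real n"
  shows "conj_commutes Homeo_c (tr 1) (tr \<alpha>) (push bump) m n \<longleftrightarrow> 1 \<le> \<bar>real m * \<alpha> - real n\<bar>"
proof -
  define d where "d = real m * \<alpha> - real n"
  have "inv\<^bsub>Homeo_c\<^esub> (tr 1 [^]\<^bsub>Homeo_c\<^esub> n) \<otimes>\<^bsub>Homeo_c\<^esub> tr \<alpha> [^]\<^bsub>Homeo_c\<^esub> m = tr d"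
    by (simp add: tr_pow tr_inv tr_mult d_def)
  moreover have "tr d \<otimes>\<^bsub>Homeo_c\<^esub> push bump \<otimes>\<^bsub>Homeo_c\<^esub> inv\<^bsub>Homeo_c\<^esub> (tr d) = push (\<lambda>x. bump (x - d) + d)"
    unfolding Homeo_c_simps tr_inv unfolding tr_def push_comp by (simp add: o_def)
  ultimately have "conj_commutes Homeo_c (tr 1) (tr \<alpha>) (push bump) m n \<longleftrightarrow>
      push (\<lambda>x. bump (x - d) + d) \<otimes>\<^bsub>Homeo_c\<^esub> push bump = push bump \<otimes>\<^bsub>Homeo_c\<^esub> push (\<lambda>x. bump (x - d) + d)"
    by (simp only: conj_commutes_def Let_def)
  also have "\<dots> \<longleftrightarrow> push (\<lambda>x. bump (bump x - d) + d) = push (\<lambda>x. bump (bump (x - d) + d))"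
    unfolding Homeo_c_simps push_comp by (simp add: o_def)
  also have "\<dots> \<longleftrightarrow> (\<forall>x. bump (bump (x - d) + d) = bump (bump x - d) + d)"
    unfolding push_eq_iff by (simp add: fun_eq_iff eq_commute)
  also have "\<dots> \<longleftrightarrow> 1 \<le> \<bar>d\<bar>"
    using bump_commutes_translate_iff[of d] assms by (simp add: d_def)
  finally show ?thesis by (simp add: d_def)
qed

text \<open>Choose \<open>m\<close> with \<open>m * (\<beta> - \<alpha>) > 2\<close> and let
  \<open>n\<close> be the integer part of \<open>m * \<alpha>\<close>: the translation for \<alpha>
  is then shorter than 1 and the one for \<beta> longer. Irrationality keeps both nonzero.\<close>

lemma conj_commutes_separates:
  assumes "\<alpha> < \<beta>" "\<alpha> \<notin> \<rat>" "\<beta> \<notin> \<rat>" "0 < \<alpha>"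
  shows "\<exists>m n. conj_commutes Homeo_c (tr 1) (tr \<alpha>) (push bump) m n \<noteq> conj_commutes Homeo_c (tr 1) (tr \<beta>) (push bump) m n"
proof -
  obtain m :: nat where m: "2 < real m * (\<beta> - \<alpha>)" using reals_Archimedean3[of "\<beta> - \<alpha>"] assms by auto
  define n where "n = nat \<lfloor>real m * \<alpha>\<rfloor>"
  have "m \<noteq> 0" using m by (cases "m = 0") auto
  have irr: "real m * \<gamma> \<noteq> real n" if "\<gamma> \<notin> \<rat>" for \<gamma>
  proof
    assume "real m * \<gamma> = real n"
    then have "\<gamma> = real n / real m" using \<open>m \<noteq> 0\<close> by (simp add: field_simps)
    then show False using that by auto
  qed
  have "0 \<le> real m * \<alpha>" using assms by simp
  then have n: "real n \<le> real m * \<alpha>" "real m * \<alpha> < real n + 1" unfolding n_def by linarith+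
  have "\<bar>real m * \<alpha> - real n\<bar> < 1" using n by linarith
  moreover have "1 \<le> \<bar>real m * \<beta> - real n\<bar>" using n m by (simp add: algebra_simps)
  ultimately show ?thesis using conj_commutes_bump irr assms by (intro exI[of _ m] exI[of _ n]) auto
qed

section \<open>Uncountably many isomorphism types\<close>

text \<open>The second use of \<open>push\<close>: it carries the line into the interval, and
  restriction provides the extensional representative.\<close>

definition emb :: "(real \<Rightarrow> real) \<Rightarrow> real \<Rightarrow> real" where
  "emb f = restrict (push f) I01"

lemma emb_apply: "x \<in> I01 \<Longrightarrow> emb f x = push f x" "x \<in> I01 \<Longrightarrow> push f x \<in> I01"
  using push_range[of x f] push_outside[of x f] by (cases "0 < x \<and> x < 1"; force simp: emb_def)+

lemma emb_mem:
  assumes "f \<in> homeo_R" shows "emb f \<in> homeo_plus_I"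
proof -
  define g where "g = inv_into UNIV f"
  have g: "g \<in> homeo_R" using assms homeo_R_inv by (simp add: g_def)
  have "f \<circ> g = id" "g \<circ> f = id"
    using homeo_R_f_inv[OF assms] homeo_R_inv_f[OF assms] by (auto simp: g_def)
  then have "push f \<circ> push g = id" "push g \<circ> push f = id"
    by (simp_all only: push_comp push_id)
  then have inv: "push f (push g x) = x" "push g (push f x) = x" for x by (auto simp: fun_eq_iff)
  have cont: "continuous_on I01 (emb h)" if "h \<in> homeo_R" for h
    using continuous_on_subset[OF homeo_R_continuous[OF homeo_c_R[OF push_homeo_c[OF that]]], of I01]
    by (rule continuous_on_eq) (simp_all add: emb_def)
  have "homeomorphism I01 I01 (emb f) (emb g)"
    by (rule homeomorphismI) (use cont assms g inv emb_apply in \<open>auto simp: image_subset_iff simp del: atLeastAtMost_iff\<close>)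
  moreover have "strict_mono_on I01 (emb f)"
    using homeo_R_less[OF homeo_c_R[OF push_homeo_c[OF assms]]] by (auto simp: strict_mono_on_def emb_def)
  ultimately show ?thesis by (auto simp: homeo_plus_I_def emb_def)
qed

lemma emb_hom: "emb \<in> hom Homeo_c Homeo_plus_I"
proof (rule homI)
  show "emb x \<in> carrier Homeo_plus_I" if "x \<in> carrier Homeo_c" for x
    using that emb_mem homeo_c_R by (simp add: Homeo_plus_I_def)
  show "emb (x \<otimes>\<^bsub>Homeo_c\<^esub> y) = emb x \<otimes>\<^bsub>Homeo_plus_I\<^esub> emb y" if "x \<in> carrier Homeo_c" "y \<in> carrier Homeo_c" for x y
  proof -
    have "emb x \<in> Bij I01" "emb y \<in> Bij I01"
      using that emb_mem homeo_c_R homeo_plus_I_subset_Bij by auto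
    then have "emb x \<otimes>\<^bsub>Homeo_plus_I\<^esub> emb y = compose I01 (emb x) (emb y)"
      by (simp add: Homeo_plus_I_def BijGroup_def)
    also have "\<dots> = emb (x \<circ> y)"
      by (rule extensionalityI[of _ I01])
        (simp_all add: compose_eq emb_apply emb_def[of "x \<circ> y"] push_comp[symmetric] del: atLeastAtMost_iff)
    finally show ?thesis by simp
  qed
qed

lemma emb_inj: "inj emb"
proof (rule injI)
  fix f g assume e: "emb f = emb g"
  have "push f x = push g x" for x
  proof (cases "0 < x \<and> x < 1")
    case True
    then show ?thesis using fun_cong[OF e, of x] by (simp add: emb_def)
  qed (simp add: push_outside)
  then have "push f = push g" by (rule ext)
  then show "f = g" by (rule push_inj)
qed

lemma emb_iso:
  assumes "subgroup S Homeo_c"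
  shows "subgroup (emb ` S) Homeo_plus_I" "emb \<in> iso (Homeo_c\<lparr>carrier := S\<rparr>) (Homeo_plus_I\<lparr>carrier := emb ` S\<rparr>)"
proof -
  interpret group_hom Homeo_c Homeo_plus_I emb
    using group_Homeo_c group_Homeo_plus_I emb_hom by (simp add: group_hom_def group_hom_axioms_def)
  show "subgroup (emb ` S) Homeo_plus_I" by (rule subgroup_img_is_subgroup[OF assms])
  show "emb \<in> iso (Homeo_c\<lparr>carrier := S\<rparr>) (Homeo_plus_I\<lparr>carrier := emb ` S\<rparr>)"
    using subgroup.subset[OF assms] emb_hom inj_on_subset[OF emb_inj, of S]
    by (auto simp: iso_def hom_def bij_betw_def subset_iff Pi_iff simp del: Homeo_c_simps)
qed

section \<open>Counting parameters against isomorphism types\<close>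

theorem corollary1p9:
  shows "uncountable
    ({S. subgroup S Homeo_plus_I \<and> countable S
         \<and> is_simple (Homeo_plus_I\<lparr>carrier := S\<rparr>)
         \<and> no_nontrivial_C1_action (Homeo_plus_I\<lparr>carrier := S\<rparr>)}
      // iso_rel Homeo_plus_I)"
proof
  define Q where "Q = {S. subgroup S Homeo_plus_I \<and> countable S
         \<and> is_simple (Homeo_plus_I\<lparr>carrier := S\<rparr>)
         \<and> no_nontrivial_C1_action (Homeo_plus_I\<lparr>carrier := S\<rparr>)}"
  assume "countable (Q // iso_rel Homeo_plus_I)"
  define A where "A = {0<..<1} - (\<rat> :: real set)"
  \<comment> \<open>The first two generators obstruct actions, the last three encode
    \<alpha>.\<close>
  define C where "C \<alpha> = {tr (1/4), push rot3, tr 1, tr \<alpha>, push bump}" for \<alpha>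
  have C: "C \<alpha> \<subseteq> carrier Homeo_c" for \<alpha>
    by (simp add: C_def tr_mem push_homeo_c rot3_homeo bump_homeo)
  have tr1: "tr (1/4) \<noteq> \<one>\<^bsub>Homeo_c\<^esub>"
    using push_inj[of "\<lambda>x. x + 1/4" id] push_id by (auto simp: tr_def fun_eq_iff)
  have "\<exists>S. subgroup S Homeo_c \<and> C \<alpha> \<subseteq> S \<and> countable S \<and> is_simple (Homeo_c\<lparr>carrier := S\<rparr>)" for \<alpha>
    by (rule countable_simple_subgroup[OF is_simple_Homeo_c _ C _ tr1]) (auto simp: C_def)
  then obtain S where S: "\<And>\<alpha>. subgroup (S \<alpha>) Homeo_c" "\<And>\<alpha>. C \<alpha> \<subseteq> S \<alpha>" "\<And>\<alpha>. countable (S \<alpha>)"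
    "\<And>\<alpha>. is_simple (Homeo_c\<lparr>carrier := S \<alpha>\<rparr>)" by metis
  let ?G = "\<lambda>\<alpha>. Homeo_c\<lparr>carrier := S \<alpha>\<rparr>"
  let ?H = "\<lambda>\<alpha>. Homeo_plus_I\<lparr>carrier := emb ` S \<alpha>\<rparr>"
  have gG: "group (?G \<alpha>)" for \<alpha> using S(4) by (simp add: is_simple_def)
  have gH: "group (?H \<alpha>)" for \<alpha>
    by (rule group.subgroup_imp_group[OF group_Homeo_plus_I emb_iso(1)[OF S(1)]])
  have C1: "no_nontrivial_C1_action (?G \<alpha>)" for \<alpha>
  proof (rule no_nontrivial_C1_action_if_triangle_relations[OF S(4)])
    show "tr (1/4) \<in> carrier (?G \<alpha>)" "push rot3 \<in> carrier (?G \<alpha>)" using S(2) by (auto simp: C_def)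
    show "tr (1/4) \<noteq> \<one>\<^bsub>?G \<alpha>\<^esub>" using tr1 by simp
    show "tr (1/4) [^]\<^bsub>?G \<alpha>\<^esub> (4::nat) = push rot3 [^]\<^bsub>?G \<alpha>\<^esub> (3::nat)"
      "(push rot3 \<otimes>\<^bsub>?G \<alpha>\<^esub> tr (1/4)) [^]\<^bsub>?G \<alpha>\<^esub> (5::nat) = tr (1/4) [^]\<^bsub>?G \<alpha>\<^esub> (12::nat)"
      using triangle_relations_Homeo_c monoid.nat_pow_consistent[OF group.is_monoid[OF group_Homeo_c], of _ _ "S \<alpha>"] by simp_all
  qed
  have memQ: "emb ` S \<alpha> \<in> Q" for \<alpha>
    using emb_iso[OF S(1)] S(3) is_simple_iso[OF emb_iso(2)[OF S(1)] S(4) gH]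
      no_nontrivial_C1_action_iso[OF emb_iso(2)[OF S(1)] C1] by (auto simp: Q_def)
  define c where "c \<alpha> = iso_rel Homeo_plus_I `` {emb ` S \<alpha>}" for \<alpha>
  have "c ` A \<subseteq> Q // iso_rel Homeo_plus_I" using memQ by (auto simp: c_def intro: quotientI)
  then have cnt: "countable (c ` A)" using \<open>countable (Q // _)\<close> countable_subset by blast
  have iso: "\<exists>\<theta>. \<theta> \<in> iso (?G \<alpha>) (?G \<beta>)" if "c \<alpha> = c \<beta>" for \<alpha> \<beta>
  proof -
    have "emb ` S \<beta> \<in> c \<beta>"
      using emb_iso(1)[OF S(1)] by (simp add: c_def iso_rel_def iso_refl)
    then have "?H \<alpha> \<cong> ?H \<beta>" unfolding that[symmetric] by (simp add: c_def iso_rel_def)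
    moreover have "?G \<gamma> \<cong> ?H \<gamma>" for \<gamma> using emb_iso(2)[OF S(1)] by (auto simp: is_iso_def)
    ultimately have "?G \<alpha> \<cong> ?G \<beta>" using group.iso_sym[OF gG] iso_trans by blast
    then show ?thesis by (auto simp: is_iso_def)
  qed
  \<comment> \<open>One representative parameter per isomorphism class, so that all groups of a
    class are mapped into a single countable group.\<close>
  define \<rho> where "\<rho> = inv_into A c"
  have \<rho>: "c (\<rho> (c \<alpha>)) = c \<alpha>" if "\<alpha> \<in> A" for \<alpha>
    unfolding \<rho>_def using that by (intro f_inv_into_f) auto
  have "\<forall>\<alpha>\<in>A. \<exists>\<theta>. \<theta> \<in> iso (?G \<alpha>) (?G (\<rho> (c \<alpha>)))" using iso \<rho> by simp
  then obtain \<theta> where \<theta>: "\<And>\<alpha>. \<alpha> \<in> A \<Longrightarrow> \<theta> \<alpha> \<in> iso (?G \<alpha>) (?G (\<rho> (c \<alpha>)))"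
    unfolding bchoice_iff by blast
  have gens: "tr 1 \<in> S \<alpha>" "tr \<alpha> \<in> S \<alpha>" "push bump \<in> S \<alpha>" for \<alpha> using S(2) by (auto simp: C_def)
  have img: "\<theta> \<alpha> g \<in> S (\<rho> (c \<alpha>))" if "\<alpha> \<in> A" "g \<in> S \<alpha>" for \<alpha> g
    using \<theta>[OF that(1)] that(2) by (auto simp: iso_def hom_def)
  \<comment> \<open>The isomorphism carries the invariant of the marked triple to that of its image;
    both are read in the ambient group, the original triple via the inclusion
    \<open>id\<close>.\<close>
  have inv: "conj_commutes Homeo_c (\<theta> \<alpha> (tr 1)) (\<theta> \<alpha> (tr \<alpha>)) (\<theta> \<alpha> (push bump)) =
      conj_commutes Homeo_c (tr 1) (tr \<alpha>) (push bump)" if \<alpha>: "\<alpha> \<in> A" for \<alpha>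
  proof (intro ext)
    fix m n
    have sub: "S \<gamma> \<subseteq> carrier Homeo_c" for \<gamma> by (rule subgroup.subset[OF S(1)])
    have "\<theta> \<alpha> \<in> hom (?G \<alpha>) Homeo_c" "inj_on (\<theta> \<alpha>) (carrier (?G \<alpha>))"
      using \<theta>[OF \<alpha>] sub by (auto simp: iso_def hom_def bij_betw_def Pi_iff subset_iff simp del: Homeo_c_simps)
    then have "conj_commutes Homeo_c (\<theta> \<alpha> (tr 1)) (\<theta> \<alpha> (tr \<alpha>)) (\<theta> \<alpha> (push bump)) m n =
        conj_commutes (?G \<alpha>) (tr 1) (tr \<alpha>) (push bump) m n"
      using gens by (intro conj_commutes_hom[OF gG group_Homeo_c]) simp_all
    also have "\<dots> = conj_commutes Homeo_c (id (tr 1)) (id (tr \<alpha>)) (id (push bump)) m n"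
      using gens subsetD[OF sub[of \<alpha>]]
      by (intro conj_commutes_hom[OF gG group_Homeo_c, symmetric]) (auto simp: hom_def simp del: Homeo_c_simps)
    finally show "conj_commutes Homeo_c (\<theta> \<alpha> (tr 1)) (\<theta> \<alpha> (tr \<alpha>)) (\<theta> \<alpha> (push bump)) m n =
        conj_commutes Homeo_c (tr 1) (tr \<alpha>) (push bump) m n" by simp
  qed
  \<comment> \<open>The class of the group together with the image of its marked triple in the
    representative. These data determine \<alpha>, yet they range over a countable set if there are
    countably many classes.\<close>
  define F where "F \<alpha> = (c \<alpha>, \<theta> \<alpha> (tr 1), \<theta> \<alpha> (tr \<alpha>), \<theta> \<alpha> (push bump))" for \<alpha>
  have "inj_on F A"
  proof (rule inj_onI)
    fix \<alpha> \<beta> assume ab: "\<alpha> \<in> A" "\<beta> \<in> A" and "F \<alpha> = F \<beta>"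
    then have eq: "conj_commutes Homeo_c (tr 1) (tr \<alpha>) (push bump) = conj_commutes Homeo_c (tr 1) (tr \<beta>) (push bump)"
      using inv[OF ab(1)] inv[OF ab(2)] by (simp add: F_def)
    show "\<alpha> = \<beta>"
      using conj_commutes_separates[of \<alpha> \<beta>] conj_commutes_separates[of \<beta> \<alpha>] ab eq
      by (cases \<alpha> \<beta> rule: linorder_cases) (auto simp: A_def)
  qed
  moreover have "F ` A \<subseteq> Sigma (c ` A) (\<lambda>q. S (\<rho> q) \<times> S (\<rho> q) \<times> S (\<rho> q))"
    using img gens by (auto simp: F_def)
  moreover have "countable (Sigma (c ` A) (\<lambda>q. S (\<rho> q) \<times> S (\<rho> q) \<times> S (\<rho> q)))"
    using cnt S(3) by (intro countable_SIGMA) auto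
  ultimately have "countable A" using countable_subset countable_image_inj_on by blast
  moreover have "uncountable A"
    unfolding A_def by (intro uncountable_minus_countable countable_rat) (simp add: uncountable_open_interval)
  ultimately show False by simp
qed

end
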